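(* Let $X$ and $Y$ be nonempty perfect Polish spaces and let $A\subseteq X\times Y$ have the Baire property, with $\{x\in X: A_x\text{ is meager in }Y\}$ meager in $X$ and $\{y\in Y: A^y\text{ is meager in }X\}$ meager in $Y$, where $A_x=\{y:(x,y)\in A\}$ and $A^y=\{x:(x,y)\in A\}$. Then there exist a comeager subset $F$ of $X$ and a comeager subset $G$ of $Y$, each of which is the union of a $K_\sigma$ set and a $G_\delta$ set, and an isomorphism of second class from $F$ onto $G$ whose graph is contained in $A$.
   Context: An isomorphism of second class from $F$ onto $G$ is a bijection $f:F\to G$ such that both $f$ and $f^{-1}$ are of (Baire) class 2, i.e. preimages of open sets under $f$ (resp. $f^{-1}$) are $\boldsymbol{\Sigma}^0_3$ in $F$ (resp. $G$). *)

theory Defs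
  imports "HOL-Analysis.Analysis"
begin

definition nowhere_dense :: "'a::topological_space set \<Rightarrow> bool" where
  "nowhere_dense S \<longleftrightarrow> interior (closure S) = {}"

definition meager :: "'a::topological_space set \<Rightarrow> bool" where
  "meager S \<longleftrightarrow> (\<exists>N :: nat \<Rightarrow> 'a set. (\<forall>n. nowhere_dense (N n)) \<and> S = (\<Union>n. N n))"

definition comeager :: "'a::topological_space set \<Rightarrow> bool" where
  "comeager S \<longleftrightarrow> meager (- S)"

definition baire_property :: "'a::topological_space set \<Rightarrow> bool" where
  "baire_property S \<longleftrightarrow> (\<exists>U. open U \<and> meager ((S - U) \<union> (U - S)))"

definition ksigma :: "'a::topological_space set \<Rightarrow> bool" where
  "ksigma S \<longleftrightarrow> (\<exists>K :: nat \<Rightarrow> 'a set. (\<forall>n. compact (K n)) \<and> S = (\<Union>n. K n))"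

text \<open>
  The finite levels \<open>n \<ge> 1\<close> of the additive Borel hierarchy of a space: \<open>\<Sigma>\<^sup>0\<^sub>1\<close> consists of the open
  sets, and \<open>\<Sigma>\<^sup>0\<^sub>n\<close> of the countable unions of complements of sets of lower levels. Level 0 is empty,
  so the second rule never applies to \<open>n \<le> 1\<close>.
\<close>

inductive Sigma0 :: "'a topology \<Rightarrow> nat \<Rightarrow> 'a set \<Rightarrow> bool" for T :: "'a topology" where
  Sigma0_open: "openin T U \<Longrightarrow> Sigma0 T 1 U"
| Sigma0_Union: "(\<And>i::nat. k i < n \<and> Sigma0 T (k i) (B i)) \<Longrightarrow> Sigma0 T n (\<Union>i. topspace T - B i)"

definition baire_class_two :: "'a topology \<Rightarrow> 'b topology \<Rightarrow> ('a \<Rightarrow> 'b) \<Rightarrow> bool" where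
  "baire_class_two S T f \<longleftrightarrow>
     f \<in> topspace S \<rightarrow> topspace T \<and>
     (\<forall>U. openin T U \<longrightarrow> Sigma0 S 3 {x \<in> topspace S. f x \<in> U})"

definition second_class_iso ::
    "'a::topological_space set \<Rightarrow> 'b::topological_space set \<Rightarrow> ('a \<Rightarrow> 'b) \<Rightarrow> bool" where
  "second_class_iso F G f \<longleftrightarrow>
     bij_betw f F G \<and>
     baire_class_two (top_of_set F) (top_of_set G) f \<and>
     baire_class_two (top_of_set G) (top_of_set F) (inv_into F f)"

end

theory Submission
  imports Defs
begin

text \<open>
  By the Kuratowski-Ulam theorem, \<open>A\<close> is comeager in an open set whose projections to both factors are
  dense, so up to a meager set \<open>X\<close> is a disjoint union of open sets \<open>U\<^sub>n\<close> with \<open>A\<close> comeager in a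
  rectangle \<open>U\<^sub>n \<times> V\<^sub>n\<close>. A generic Cantor set \<open>P\<^sub>n \<subseteq> V\<^sub>n\<close> satisfies \<open>H\<^sub>n \<times> P\<^sub>n \<subseteq> A\<close> for some \<open>H\<^sub>n\<close>
  comeager in \<open>U\<^sub>n\<close>; the \<open>P\<^sub>n\<close> can be taken disjoint and nowhere dense, and Cantor sets \<open>Q\<^sub>m \<subseteq> X\<close> are
  found symmetrically. Since only the product \<open>H\<^sub>n \<times> P\<^sub>n\<close> matters, \<open>H\<^sub>n\<close> may still be shrunk: inside it and
  off the meager set \<open>\<Union>\<^sub>m Q\<^sub>m\<close> there is a dense \<open>G\<^sub>\<delta>\<close> copy of the Baire space, that is, of \<open>P\<^sub>n\<close> minus a
  countable set, and the missing points are matched with countably many further points of \<open>H\<^sub>n\<close>.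
  This maps a comeager subset of \<open>X\<close> onto \<open>\<Union>\<^sub>n P\<^sub>n\<close>. Its union with the inverse of the symmetric map,
  which starts from \<open>\<Union>\<^sub>m Q\<^sub>m\<close>, is a homeomorphism on each of countably many \<open>G\<^sub>\<delta>\<^sub>\<sigma>\<close> pieces,
  hence of second class in both directions.
\<close>

section \<open>Meager sets\<close>

text \<open>Closures of nowhere dense sets are closed with empty interior, and conversely each trace
  \<open>S \<inter> C n\<close> of a cover is nowhere dense. In this form passing to subsets and
  countable unions is immediate.\<close>

lemma meager_iff_closed_cover:
  "meager S \<longleftrightarrow> (\<exists>C :: nat \<Rightarrow> 'a::topological_space set.
     (\<forall>n. closed (C n) \<and> interior (C n) = {}) \<and> S \<subseteq> (\<Union>n. C n))"
proof
  assume "meager S"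
  then obtain N :: "nat \<Rightarrow> 'a set" where N: "\<And>n. nowhere_dense (N n)" "S = (\<Union>n. N n)"
    unfolding meager_def by blast
  have "S \<subseteq> (\<Union>n. closure (N n))"
    unfolding N(2) by (intro UN_mono closure_subset) auto
  moreover have "closed (closure (N n)) \<and> interior (closure (N n)) = {}" for n
    using N(1)[of n] by (simp add: nowhere_dense_def)
  ultimately show "\<exists>C :: nat \<Rightarrow> 'a set. (\<forall>n. closed (C n) \<and> interior (C n) = {}) \<and> S \<subseteq> (\<Union>n. C n)"
    by (intro exI[of _ "\<lambda>n. closure (N n)"]) simp
next
  assume "\<exists>C :: nat \<Rightarrow> 'a set. (\<forall>n. closed (C n) \<and> interior (C n) = {}) \<and> S \<subseteq> (\<Union>n. C n)"
  then obtain C :: "nat \<Rightarrow> 'a set"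
    where C: "\<And>n. closed (C n)" "\<And>n. interior (C n) = {}" "S \<subseteq> (\<Union>n. C n)"
    by blast
  have "nowhere_dense (S \<inter> C n)" for n
    using C interior_mono[of "closure (S \<inter> C n)" "C n"] closure_minimal[of "S \<inter> C n" "C n"]
    unfolding nowhere_dense_def by auto
  moreover have "S = (\<Union>n. S \<inter> C n)"
    using C by blast
  ultimately show "meager S"
    unfolding meager_def by (intro exI[of _ "\<lambda>n. S \<inter> C n"]) auto
qed

lemma meager_subset: "meager T \<Longrightarrow> S \<subseteq> T \<Longrightarrow> meager S"
  unfolding meager_iff_closed_cover by (meson subset_trans)

lemma meager_closed: "closed S \<Longrightarrow> interior S = {} \<Longrightarrow> meager S"
  unfolding meager_iff_closed_cover by (intro exI[of _ "\<lambda>_. S"]) auto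

lemma meager_empty [simp]: "meager {}"
  by (rule meager_closed) auto

lemma meager_UN_nat:
  fixes S :: "nat \<Rightarrow> 'a::topological_space set"
  assumes "\<And>n. meager (S n)"
  shows "meager (\<Union>n. S n)"
proof -
  have "\<forall>n. \<exists>C :: nat \<Rightarrow> 'a set. (\<forall>k. closed (C k) \<and> interior (C k) = {}) \<and> S n \<subseteq> (\<Union>k. C k)"
    using assms unfolding meager_iff_closed_cover by blast
  then obtain C :: "nat \<Rightarrow> nat \<Rightarrow> 'a set"
    where C: "\<And>n k. closed (C n k)" "\<And>n k. interior (C n k) = {}" "\<And>n. S n \<subseteq> (\<Union>k. C n k)"
    by metis
  have "(\<Union>n. S n) \<subseteq> (\<Union>m. C (fst (prod_decode m)) (snd (prod_decode m)))"
  proof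
    fix x assume "x \<in> (\<Union>n. S n)"
    then obtain n k where "x \<in> C n k"
      using C(3) by blast
    then show "x \<in> (\<Union>m. C (fst (prod_decode m)) (snd (prod_decode m)))"
      by (intro UN_I[of "prod_encode (n, k)"]) auto
  qed
  then show ?thesis
    unfolding meager_iff_closed_cover
    by (intro exI[of _ "\<lambda>m. C (fst (prod_decode m)) (snd (prod_decode m))"]) (auto simp: C)
qed

lemma meager_UN:
  assumes "countable I" "\<And>i. i \<in> I \<Longrightarrow> meager (S i)"
  shows "meager (\<Union>i\<in>I. S i)"
proof (cases "I = {}")
  case False
  then have "(\<Union>i\<in>I. S i) = (\<Union>n. S (from_nat_into I n))"
    using assms(1) by (metis image_image range_from_nat_into)
  then show ?thesis
    using assms(2) False by (simp add: meager_UN_nat from_nat_into)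
qed simp

lemma meager_Un: "meager S \<Longrightarrow> meager T \<Longrightarrow> meager (S \<union> T)"
  using meager_UN[of "{S, T}" id] by auto

lemma meager_countable:
  fixes S :: "'a::{t1_space, perfect_space} set"
  assumes "countable S"
  shows "meager S"
proof -
  have "meager {x}" for x :: 'a
    by (rule meager_closed) (auto simp: interior_singleton)
  then show ?thesis
    using meager_UN[OF assms, of "\<lambda>x. {x}"] by simp
qed

section \<open>Baire category and bookkeeping of open sets\<close>

lemma not_meager_open:
  fixes U :: "'a::complete_space set"
  assumes "open U" "U \<noteq> {}"
  shows "\<not> meager U"
proof
  assume "meager U"
  then obtain C :: "nat \<Rightarrow> 'a set"
    where C: "\<And>n. closed (C n)" "\<And>n. interior (C n) = {}" "U \<subseteq> (\<Union>n. C n)"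
    unfolding meager_iff_closed_cover by blast
  have "euclidean interior_of \<Union>(range C) = {}"
    by (rule Baire_category_alt) (auto simp: completely_metrizable_space_euclidean C)
  then have "interior (\<Union>(range C)) = {}"
    by simp
  moreover have "U \<subseteq> interior (\<Union>(range C))"
    using C(3) assms(1) by (simp add: interior_maximal)
  ultimately show False
    using assms by blast
qed

text \<open>The closed set \<open>closure U - W\<close> has empty interior: its interior meets
  \<open>U\<close> in an open set missing \<open>W\<close>, so it misses \<open>U\<close>, and being
  open it then misses \<open>closure U\<close>.\<close>

lemma meager_complement_open_dense:
  assumes "open W" "\<And>O'. open O' \<Longrightarrow> O' \<noteq> {} \<Longrightarrow> O' \<subseteq> U \<Longrightarrow> O' \<inter> W \<noteq> {}" "open U"
  shows "meager (U - W)"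
proof (rule meager_subset[of "closure U - W"])
  show "meager (closure U - W)"
  proof (rule meager_closed)
    let ?I = "interior (closure U - W)"
    have "?I \<inter> U \<inter> W = {}"
      using interior_subset[of "closure U - W"] by blast
    then have "?I \<inter> U = {}"
      using assms by (metis Int_lower2 open_Int open_interior)
    then have "?I \<inter> closure U = {}"
      by (simp add: open_Int_closure_eq_empty)
    then show "?I = {}"
      using interior_subset[of "closure U - W"] by blast
  qed (simp add: assms closed_Diff)
qed (use closure_subset in auto)

text \<open>Complements of finite unions of the covering closed sets. The sequence decreases, so a
  point that is in \<open>D n\<close> for infinitely many \<open>n\<close> already avoids
  \<open>M\<close>.\<close>

lemma meager_open_avoid:
  fixes M :: "'a::topological_space set"
  assumes "meager M"
  obtains D :: "nat \<Rightarrow> 'a set"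
  where "\<And>n. open (D n)" "\<And>n. D (Suc n) \<subseteq> D n" "M \<inter> (\<Inter>n. D n) = {}"
    "\<And>n O'. open O' \<Longrightarrow> O' \<noteq> {} \<Longrightarrow> O' \<inter> D n \<noteq> {}"
proof -
  obtain C :: "nat \<Rightarrow> 'a set"
    where C: "\<And>n. closed (C n)" "\<And>n. interior (C n) = {}" "M \<subseteq> (\<Union>n. C n)"
    using assms unfolding meager_iff_closed_cover by blast
  define D where "D n = - (\<Union>i\<le>n. C i)" for n
  have "interior (\<Union>i\<le>n. C i) = {}" for n
  proof (induction n)
    case 0
    then show ?case by (simp add: C)
  next
    case (Suc n)
    have "closed (\<Union>i\<le>n. C i)"
      by (intro closed_UN) (auto simp: C)
    then show ?case
      using Suc C(1,2) interior_closed_Un_empty_interior[of "\<Union>i\<le>n. C i" "C (Suc n)"]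
      by (simp add: atMost_Suc Un_commute)
  qed
  then have dense: "O' \<inter> D n \<noteq> {}" if "open O'" "O' \<noteq> {}" for n O'
    using that interior_maximal[of O' "\<Union>i\<le>n. C i"] unfolding D_def
    by (metis disjoint_eq_subset_Compl double_compl subset_empty)
  have "open (D n)" for n
    unfolding D_def by (intro open_Compl closed_UN) (auto simp: C)
  moreover have "D (Suc n) \<subseteq> D n" for n
    unfolding D_def by auto
  moreover have "M \<inter> (\<Inter>n. D n) = {}"
    using C(3) unfolding D_def by auto
  ultimately show thesis
    using dense by (intro that[of D])
qed

text \<open>Indexing by pairs makes every basic set recur arbitrarily late. A recursion that treats
  only \<open>B k\<close> at stage \<open>k\<close> can therefore still reach every open set after
  any given stage.\<close>

lemma obtain_repeating_base:
  obtains B :: "nat \<Rightarrow> 'a::second_countable_topology set"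
  where "\<And>n. open (B n)"
    "\<And>O' n. open O' \<Longrightarrow> O' \<noteq> {} \<Longrightarrow> \<exists>k\<ge>n. B k \<noteq> {} \<and> B k \<subseteq> O'"
proof -
  obtain \<B> :: "'a set set" where \<B>: "countable \<B>" "topological_basis \<B>"
    using ex_countable_basis by blast
  have ne: "\<B> \<noteq> {}"
    using topological_basisE[OF \<B>(2) open_UNIV UNIV_I] by blast
  define B where "B n = from_nat_into \<B> (fst (prod_decode n))" for n
  have "\<exists>k\<ge>n. B k \<noteq> {} \<and> B k \<subseteq> O'" if O': "open O'" "O' \<noteq> {}" for O' n
  proof -
    obtain x where "x \<in> O'"
      using O' by blast
    then obtain b where b: "b \<in> \<B>" "x \<in> b" "b \<subseteq> O'"
      using topological_basisE[OF \<B>(2) O'(1)] by metis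
    let ?k = "prod_encode (to_nat_on \<B> b, n)"
    have "B ?k = b"
      unfolding B_def using b \<B> by simp
    then show ?thesis
      using b le_prod_encode_2[of n "to_nat_on \<B> b"] by (intro exI[of _ ?k]) auto
  qed
  moreover have "open (B n)" for n
    unfolding B_def using \<B>(2) ne by (simp add: from_nat_into topological_basis_open)
  ultimately show thesis
    by (intro that[of B])
qed

section \<open>Meager sets in products\<close>

lemma meager_swap:
  fixes M :: "('a::topological_space \<times> 'b::topological_space) set"
  assumes "meager M"
  shows "meager (prod.swap ` M)"
proof -
  obtain C :: "nat \<Rightarrow> ('a \<times> 'b) set"
    where C: "\<And>n. closed (C n)" "\<And>n. interior (C n) = {}" "M \<subseteq> (\<Union>n. C n)"
    using assms unfolding meager_iff_closed_cover by blast
  have eq: "prod.swap ` S = prod.swap -` S" for S :: "('c \<times> 'd) set"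
    by force
  have cl: "closed (prod.swap -` C n)" for n
    by (rule closed_vimage) (auto intro!: continuous_intros simp: C prod.swap_def)
  have "interior (prod.swap -` C n) = {}" for n
  proof -
    let ?I = "interior (prod.swap -` C n)"
    have "open (prod.swap -` ?I)"
      by (rule open_vimage) (auto intro!: continuous_intros simp: prod.swap_def)
    moreover have "prod.swap -` ?I \<subseteq> C n"
      using interior_subset[of "prod.swap -` C n"] by force
    ultimately have "prod.swap -` ?I = {}"
      using C(2) interior_maximal by blast
    then have "prod.swap -` (prod.swap -` ?I) = {}"
      by simp
    then show ?thesis
      by (simp add: vimage_def)
  qed
  then show ?thesis
    unfolding meager_iff_closed_cover eq
    by (intro exI[of _ "\<lambda>n. prod.swap -` C n"] conjI allI cl) (use C(3) in fastforce)+
qed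

text \<open>One direction of the Kuratowski-Ulam theorem. A section of a closed set that is not
  nowhere dense contains a nonempty basic open set, and for each basic set this happens only for a
  nowhere dense set of \<open>x\<close>.\<close>

lemma meager_sections:
  fixes M :: "('a::topological_space \<times> 'b::second_countable_topology) set"
  assumes "meager M"
  shows "meager {x. \<not> meager {y. (x, y) \<in> M}}"
proof -
  obtain C :: "nat \<Rightarrow> ('a \<times> 'b) set"
    where C: "\<And>n. closed (C n)" "\<And>n. interior (C n) = {}" "M \<subseteq> (\<Union>n. C n)"
    using assms unfolding meager_iff_closed_cover by blast
  obtain B :: "nat \<Rightarrow> 'b set" where B: "\<And>n. open (B n)"
    "\<And>O' n. open O' \<Longrightarrow> O' \<noteq> {} \<Longrightarrow> \<exists>k\<ge>n. B k \<noteq> {} \<and> B k \<subseteq> O'"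
    using obtain_repeating_base by blast
  \<comment> \<open>\<open>W n k\<close> is the set of \<open>x\<close> for which \<open>B k\<close>
    is not contained in the section of \<open>C n\<close> at \<open>x\<close>; as a projection of an
    open set it is open.\<close>
  define W where "W n k = fst ` ((UNIV \<times> B k) - C n)" for n k
  have "meager (- W n k)" if "B k \<noteq> {}" for n k
  proof -
    have "meager (UNIV - W n k)"
    proof (rule meager_complement_open_dense)
      show "open (W n k)"
        unfolding W_def by (intro open_image_fst open_Diff open_Times) (auto simp: B C)
      fix O' :: "'a set" assume "open O'" "O' \<noteq> {}"
      have "\<not> O' \<times> B k \<subseteq> C n"
        using interior_maximal[of "O' \<times> B k" "C n"] \<open>open O'\<close> \<open>O' \<noteq> {}\<close> that B C(2)[of n]
        by (auto simp: open_Times)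
      then show "O' \<inter> W n k \<noteq> {}"
        unfolding W_def by (force simp: image_iff)
    qed simp
    then show ?thesis
      by (simp add: Compl_eq_Diff_UNIV)
  qed
  then have "meager (\<Union>n. \<Union>k\<in>{k. B k \<noteq> {}}. - W n k)"
    by (intro meager_UN) auto
  moreover have "{x. \<not> meager {y. (x, y) \<in> M}} \<subseteq> (\<Union>n. \<Union>k\<in>{k. B k \<noteq> {}}. - W n k)"
  proof (clarify, rule ccontr)
    fix x assume nm: "\<not> meager {y. (x, y) \<in> M}"
      and x: "x \<notin> (\<Union>n. \<Union>k\<in>{k. B k \<noteq> {}}. - W n k)"
    have "closed {y. (x, y) \<in> C n}" for n
      using closed_vimage[OF C(1)[of n], of "Pair x"] by (simp add: vimage_def continuous_on_Pair)
    moreover have "interior {y. (x, y) \<in> C n} = {}" for n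
    proof (rule ccontr)
      assume "interior {y. (x, y) \<in> C n} \<noteq> {}"
      then obtain k where k: "B k \<noteq> {}" "B k \<subseteq> {y. (x, y) \<in> C n}"
        using B(2)[OF open_interior, of "{y. (x, y) \<in> C n}" 0] interior_subset by blast
      then have "x \<notin> W n k"
        unfolding W_def by auto
      then show False
        using x k by blast
    qed
    moreover have "{y. (x, y) \<in> M} \<subseteq> (\<Union>n. {y. (x, y) \<in> C n})"
      using C(3) by blast
    ultimately show False
      using nm unfolding meager_iff_closed_cover by (metis (no_types, lifting))
  qed
  ultimately show ?thesis
    by (rule meager_subset)
qed

section \<open>Schemes of open sets\<close>

text \<open>The newest bit stands at the head, so that the children of a node \<open>t\<close> are
  \<open>b # t\<close> and its ancestors are the tails of \<open>t\<close>.\<close>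

primrec bits :: "(nat \<Rightarrow> bool) \<Rightarrow> nat \<Rightarrow> bool list" where
  "bits a 0 = []"
| "bits a (Suc n) = a n # bits a n"

lemma length_bits [simp]: "length (bits a n) = n"
  by (induction n) auto

lemma bits_eq_iff: "bits a n = bits b n \<longleftrightarrow> (\<forall>i<n. a i = b i)"
  by (induction n) (auto simp: less_Suc_eq)

lemma scheme_antimono:
  assumes "\<And>b t. V (b # t) \<subseteq> V t" "m \<le> n"
  shows "V (bits a n) \<subseteq> V (bits a m)"
  using assms(2) by (induction n rule: dec_induct) (use assms(1) in auto)

text \<open>By monotonicity and induction the tails agree; the heads then agree because siblings are
  disjoint.\<close>

lemma scheme_same_level:
  assumes mono: "\<And>b t. V (b # t) \<subseteq> V t" and disj: "\<And>t. V (True # t) \<inter> V (False # t) = {}"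
    and "length s = length t" "x \<in> V s" "x \<in> V t"
  shows "s = t"
  using assms(3-5)
proof (induction rule: list_induct2)
  case (Cons b s c t)
  then have "s = t"
    using mono by blast
  moreover have "b = c"
    using disj[of s] Cons.prems \<open>s = t\<close> by (cases b; cases c) auto
  ultimately show ?case
    by simp
qed simp

text \<open>Nesting of closures and small diameters are demanded only at infinitely many levels of a
  branch, which admits schemes where some steps shrink nothing. Points chosen along a branch are
  Cauchy, their limit stays in every set of the branch, and disjointness of siblings recovers the
  branch from the limit.\<close>

lemma scheme_homeomorphism:
  fixes V :: "bool list \<Rightarrow> 'a::complete_space set"
  assumes opn: "\<And>t. open (V t)" and ne: "\<And>t. V t \<noteq> {}"
    and mono: "\<And>b t. V (b # t) \<subseteq> V t"
    and disj: "\<And>t. V (True # t) \<inter> V (False # t) = {}"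
    and small: "\<And>a n. a \<in> S \<Longrightarrow> \<exists>m\<ge>n. closure (V (bits a (Suc m))) \<subseteq> V (bits a m) \<and>
          (\<forall>x\<in>V (bits a (Suc m)). \<forall>y\<in>V (bits a (Suc m)). dist x y \<le> (1/2) ^ m)"
  obtains e d where "homeomorphism S (e ` S) e d"
    "\<And>a n. a \<in> S \<Longrightarrow> e a \<in> V (bits a n)"
    "\<And>x a. a \<in> S \<Longrightarrow> (\<And>n. x \<in> V (bits a n)) \<Longrightarrow> x = e a"
proof -
  have small': "\<exists>m\<ge>n. closure (V (bits a (Suc m))) \<subseteq> V (bits a m) \<and>
      (\<forall>x\<in>V (bits a (Suc m)). \<forall>y\<in>V (bits a (Suc m)). dist x y < \<epsilon>)"
    if a: "a \<in> S" and "0 < \<epsilon>" for a n and \<epsilon> :: real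
  proof -
    obtain k where k: "(1/2) ^ k < \<epsilon>"
      using real_arch_pow_inv[OF \<open>0 < \<epsilon>\<close>, of "1/2"] by auto
    obtain m where m: "m \<ge> max n k" "closure (V (bits a (Suc m))) \<subseteq> V (bits a m)"
      "\<forall>x\<in>V (bits a (Suc m)). \<forall>y\<in>V (bits a (Suc m)). dist x y \<le> (1/2) ^ m"
      using small[OF a, of "max n k"] by blast
    have "(1/2::real) ^ m \<le> (1/2) ^ k"
      using m(1) by (intro power_decreasing) auto
    then have "(1/2) ^ m < \<epsilon>"
      using k by (rule le_less_trans)
    then have "\<forall>x\<in>V (bits a (Suc m)). \<forall>y\<in>V (bits a (Suc m)). dist x y < \<epsilon>"
      using m(3) le_less_trans by blast
    then show ?thesis
      using m by (intro exI[of _ m]) simp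
  qed
  have "\<exists>x. \<forall>n. x \<in> V (bits a n)" if a: "a \<in> S" for a
  proof -
    have "\<forall>n. \<exists>x. x \<in> V (bits a n)"
      using ne by blast
    then obtain u where u: "\<And>n. u n \<in> V (bits a n)"
      by metis
    have late: "u k \<in> V (bits a m)" if "m \<le> k" for m k
      using u[of k] scheme_antimono[of V, OF mono that] by blast
    have "Cauchy u"
    proof (rule metric_CauchyI)
      fix \<epsilon> :: real assume "0 < \<epsilon>"
      then obtain m where "\<forall>x\<in>V (bits a (Suc m)). \<forall>y\<in>V (bits a (Suc m)). dist x y < \<epsilon>"
        using small'[OF a] by blast
      then show "\<exists>M. \<forall>m\<ge>M. \<forall>n\<ge>M. dist (u m) (u n) < \<epsilon>"
        using late by blast
    qed
    then obtain x where x: "u \<longlonglongrightarrow> x"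
      using Cauchy_convergent convergent_def by blast
    have "x \<in> V (bits a n)" for n
    proof -
      obtain m where m: "m \<ge> n" "closure (V (bits a (Suc m))) \<subseteq> V (bits a m)"
        using small'[OF a, of 1 n] by auto
      have "\<forall>\<^sub>F k in sequentially. u k \<in> closure (V (bits a (Suc m)))"
        using late closure_subset by (intro eventually_sequentiallyI[of "Suc m"]) blast
      \<comment> \<open>The closure at level \<open>Suc m\<close> lies inside the open set at level
        \<open>m\<close>, hence inside the one at the smaller level \<open>n\<close>.\<close>
      then have "x \<in> closure (V (bits a (Suc m)))"
        by (rule Lim_in_closed_set[OF closed_closure _ sequentially_bot x])
      then show ?thesis
        using m scheme_antimono[of V, OF mono m(1)] by blast
    qed
    then show ?thesis
      by blast
  qed
  then obtain e where e: "\<And>a n. a \<in> S \<Longrightarrow> e a \<in> V (bits a n)"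
    by metis
  have level: "bits a n = bits b n" if "b \<in> S" "e b \<in> V (bits a n)" for a b n
    using scheme_same_level[of V "bits a n" "bits b n" "e b", OF mono disj] that e by simp
  have inj: "inj_on e S"
  proof (rule inj_onI)
    fix a b assume ab: "a \<in> S" "b \<in> S" "e a = e b"
    then have "bits a n = bits b n" for n
      using e level by metis
    then have "a i = b i" for i
      by (metis bits_eq_iff lessI)
    then show "a = b"
      by blast
  qed
  have uniq: "x = e a" if a: "a \<in> S" and x: "\<And>n. x \<in> V (bits a n)" for x a
  proof (rule ccontr)
    assume "x \<noteq> e a"
    then obtain m where "\<forall>y\<in>V (bits a (Suc m)). \<forall>z\<in>V (bits a (Suc m)). dist y z < dist x (e a)"
      using small'[OF a, of "dist x (e a)" 0] by auto
    then show False
      using x e[OF a] by blast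
  qed
  have cont: "continuous_on S e"
    unfolding continuous_on_topological
  proof (intro ballI allI impI)
    fix a B assume a: "a \<in> S" and B: "open B" "e a \<in> B"
    then obtain \<epsilon> where \<epsilon>: "0 < \<epsilon>" "ball (e a) \<epsilon> \<subseteq> B"
      using openE by blast
    then obtain m where m: "\<forall>x\<in>V (bits a (Suc m)). \<forall>y\<in>V (bits a (Suc m)). dist x y < \<epsilon>"
      using small'[OF a] by blast
    \<comment> \<open>The cylinder of codes agreeing with \<open>a\<close> up to the level where the
      diameter is below \<epsilon>.\<close>
    let ?A = "{b. \<forall>i\<in>{..<Suc m}. b i \<in> {a i}}"
    have "open ?A"
      by (rule product_topology_basis') (auto intro: open_discrete)
    moreover have "e b \<in> B" if "b \<in> S" "b \<in> ?A" for b
    proof -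
      have "bits b (Suc m) = bits a (Suc m)"
        using that(2) unfolding bits_eq_iff by auto
      then have "e b \<in> V (bits a (Suc m))"
        using e[OF that(1)] by metis
      then have "dist (e a) (e b) < \<epsilon>"
        using m e[OF a, of "Suc m"] by blast
      then show ?thesis
        using \<epsilon>(2) by auto
    qed
    ultimately show "\<exists>A. open A \<and> a \<in> A \<and> (\<forall>y\<in>S. y \<in> A \<longrightarrow> e y \<in> B)"
      by (intro exI[of _ ?A]) auto
  qed
  let ?d = "inv_into S e"
  have cont_inv: "continuous_on (e ` S) ?d"
  proof (rule continuous_on_coordinatewise_then_product)
    fix n
    show "continuous_on (e ` S) (\<lambda>x. ?d x n)"
      unfolding continuous_on_topological
    proof (intro ballI allI impI)
      fix x B assume x: "x \<in> e ` S" and B: "open B" "?d x n \<in> B"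
      then obtain a where a: "a \<in> S" "x = e a"
        by blast
      \<comment> \<open>On the open set \<open>V (bits a (Suc n))\<close> the \<open>n\<close>-th
        coordinate of the inverse is constantly \<open>a n\<close>.\<close>
      have "?d y n \<in> B" if y: "y \<in> e ` S" "y \<in> V (bits a (Suc n))" for y
      proof -
        obtain b where b: "b \<in> S" "y = e b"
          using y(1) by blast
        then have "bits a (Suc n) = bits b (Suc n)"
          using level y(2) by blast
        then show ?thesis
          using B(2) a b inj by simp
      qed
      then show "\<exists>A. open A \<and> x \<in> A \<and> (\<forall>y\<in>e ` S. y \<in> A \<longrightarrow> ?d y n \<in> B)"
        using a(2) e[OF a(1), of "Suc n"] opn[of "bits a (Suc n)"]
        by (intro exI[of _ "V (bits a (Suc n))"]) simp
    qed
  qed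
  have "homeomorphism S (e ` S) e ?d"
    using cont cont_inv inj by (intro homeomorphismI) auto
  then show thesis
    using e uniq by (rule that)
qed

section \<open>Generic copies of the Baire space\<close>

lemma obtain_small_open:
  fixes T :: "'a::metric_space set"
  assumes "open T" "x \<in> T" "0 < \<epsilon>"
  obtains W where "open W" "x \<in> W" "closure W \<subseteq> T" "\<And>y z. y \<in> W \<Longrightarrow> z \<in> W \<Longrightarrow> dist y z \<le> \<epsilon>"
proof -
  obtain r where r: "0 < r" "cball x r \<subseteq> T"
    using assms(1,2) open_contains_cball by blast
  let ?W = "ball x (min r (\<epsilon>/2))"
  have "closure ?W \<subseteq> cball x r"
    by (rule closure_minimal) auto
  moreover have "dist y z \<le> \<epsilon>" if "y \<in> ?W" "z \<in> ?W" for y z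
    using that dist_triangle_half_l[of y x \<epsilon> z] by (auto simp: dist_commute)
  ultimately show thesis
    using r assms by (intro that[of ?W]) auto
qed

lemma open_perfect_other_point:
  fixes T :: "'a::perfect_space set"
  assumes "open T" "x \<in> T"
  obtains y where "y \<in> T" "y \<noteq> x"
proof -
  have "T \<noteq> {x}"
    using assms not_open_singleton by blast
  then show thesis
    using that assms(2) by blast
qed

text \<open>
  The branch \<open>a\<close> passes to \<open>True # t\<close> for a small piece of the current open set and to \<open>False # t\<close>
  for the exterior of that piece. Branches with infinitely many \<open>True\<close> determine points, and because
  the pieces eventually enter every basic open set, generic points are on such branches.
\<close>

lemma generic_set_homeomorphic_infinite_codes:
  fixes U :: "'a::{polish_space, perfect_space} set"
  assumes U: "open U" "U \<noteq> {}" and M: "meager M"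
  obtains H e d where "gdelta H" "H \<subseteq> U - M" "meager (U - H)"
    "homeomorphism {a. infinite {n::nat. a n}} H e d"
proof -
  obtain D where D: "\<And>n. open (D n)" "\<And>n. D (Suc n) \<subseteq> D n" "M \<inter> (\<Inter>n. D n) = {}"
    "\<And>n O'. open O' \<Longrightarrow> O' \<noteq> {} \<Longrightarrow> O' \<inter> D n \<noteq> {}"
    using meager_open_avoid[OF M] by metis
  obtain B :: "nat \<Rightarrow> 'a set" where B: "\<And>n. open (B n)"
    "\<And>O' n. open O' \<Longrightarrow> O' \<noteq> {} \<Longrightarrow> \<exists>k\<ge>n. B k \<noteq> {} \<and> B k \<subseteq> O'"
    using obtain_repeating_base by blast
  \<comment> \<open>Requirements on the \<open>True\<close> child \<open>W\<close> of a node set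
    \<open>E\<close> at level \<open>j\<close>. The clause on \<open>E - closure W\<close> keeps the
    \<open>False\<close> child nonempty, and the one on \<open>B j\<close> will give
    density.\<close>
  define good where "good E j W \<longleftrightarrow> open W \<and> W \<noteq> {} \<and> closure W \<subseteq> E \<inter> D j \<and> E - closure W \<noteq> {} \<and>
     (\<forall>x\<in>W. \<forall>y\<in>W. dist x y \<le> (1/2) ^ j) \<and> (B j \<inter> E \<noteq> {} \<longrightarrow> W \<subseteq> B j)"
    for E j W
  have "\<exists>W. good E j W" if E: "open E" "E \<noteq> {}" for E j
  proof -
    define T where "T = (if B j \<inter> E \<noteq> {} then B j \<inter> E else E)"
    have T: "open T" "T \<noteq> {}" "T \<subseteq> E"
      using E B(1)[of j] by (auto simp: T_def)
    then obtain p where p: "p \<in> T" "p \<in> D j"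
      using D(4)[of T j] by blast
    \<comment> \<open>This second point is kept out of \<open>closure W\<close>, so the exterior of
      the piece is nonempty.\<close>
    then obtain q where q: "q \<in> T" "q \<noteq> p"
      using open_perfect_other_point[OF T(1)] by metis
    then have "open (T \<inter> D j - {q})" "p \<in> T \<inter> D j - {q}"
      using T(1) D(1)[of j] p by (auto intro: open_Diff)
    then obtain W where W: "open W" "p \<in> W" "closure W \<subseteq> T \<inter> D j - {q}"
      "\<And>y z. y \<in> W \<Longrightarrow> z \<in> W \<Longrightarrow> dist y z \<le> (1/2) ^ j"
      using obtain_small_open[of "T \<inter> D j - {q}" p "(1/2) ^ j"] by auto
    have "W \<subseteq> B j" if "B j \<inter> E \<noteq> {}"
      using that W(3) closure_subset[of W] by (auto simp: T_def)
    then have "good E j W"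
      unfolding good_def using W q T(3) by blast
    then show ?thesis
      by blast
  qed
  then obtain w where w: "\<And>E j. open E \<Longrightarrow> E \<noteq> {} \<Longrightarrow> good E j (w E j)"
    by metis
  define E where "E = rec_list U (\<lambda>b t E. if b then w E (length t) else E - closure (w E (length t)))"
  have E_simps: "E [] = U" "E (True # t) = w (E t) (length t)"
    "E (False # t) = E t - closure (E (True # t))" for t
    by (simp_all add: E_def)
  have E: "open (E t)" "E t \<noteq> {}" for t
  proof (induction t)
    case (Cons b t)
    { case 1 show ?case
        using w[of "E t" "length t"] Cons by (cases b) (auto simp: E_simps good_def) }
    { case 2 show ?case
        using w[of "E t" "length t"] Cons by (cases b) (auto simp: E_simps good_def) }
  qed (use U in \<open>auto simp: E_simps\<close>)
  have good_E: "good (E t) (length t) (E (True # t))" for t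
    using w[OF E] by (simp add: E_simps)
  have mono: "E (b # t) \<subseteq> E t" for b t
    using good_E[of t] closure_subset[of "E (True # t)"] by (cases b) (auto simp: E_simps(3) good_def)
  have disj: "E (True # t) \<inter> E (False # t) = {}" for t
    using closure_subset[of "E (True # t)"] by (auto simp: E_simps(3))
  let ?S = "{a. infinite {n. a n}}"
  have small: "\<exists>m\<ge>n. closure (E (bits a (Suc m))) \<subseteq> E (bits a m) \<and>
          (\<forall>x\<in>E (bits a (Suc m)). \<forall>y\<in>E (bits a (Suc m)). dist x y \<le> (1/2) ^ m)"
    if a: "a \<in> ?S" for a n
  proof -
    obtain m where m: "m \<ge> n" "a m"
      using a unfolding infinite_nat_iff_unbounded_le by auto
    then show ?thesis
      using good_E[of "bits a m"] by (intro exI[of _ m]) (auto simp: good_def)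
  qed
  obtain e d where ed: "homeomorphism ?S (e ` ?S) e d"
    "\<And>a n. a \<in> ?S \<Longrightarrow> e a \<in> E (bits a n)"
    "\<And>x a. a \<in> ?S \<Longrightarrow> (\<And>n. x \<in> E (bits a n)) \<Longrightarrow> x = e a"
    using scheme_homeomorphism[of E ?S, OF E mono disj small] by metis
  define ones where "ones t = length (filter id t)" for t :: "bool list"
  \<comment> \<open>The points lying in a node with at least \<open>m\<close> bits
    \<open>True\<close>. The intersection of these open sets turns out to be the range of
    \<open>e\<close>, which makes that range a \<open>G_delta\<close> set.\<close>
  define Q where "Q m = (\<Union>t\<in>{t. m \<le> ones t}. E t)" for m
  have open_Q: "open (Q m)" for m
    unfolding Q_def using E by auto
  \<comment> \<open>An open set missing all such \<open>E s\<close> would survive every passage to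
    the exterior below \<open>t\<close>. At a level \<open>j\<close> with
    \<open>B j \<subseteq> O'\<close> the next piece is chosen inside \<open>B j\<close>, so it does
    meet \<open>O'\<close>.\<close>
  have step: "\<exists>s. ones s = Suc (ones t) \<and> O' \<inter> E s \<noteq> {}"
    if O': "open O'" "O' \<noteq> {}" "O' \<subseteq> E t" for O' t
  proof (rule ccontr)
    assume contr: "\<not> ?thesis"
    obtain j where j: "j \<ge> length t" "B j \<noteq> {}" "B j \<subseteq> O'"
      using B(2)[OF O'(1,2)] by metis
    have "O' \<subseteq> E (replicate k False @ t)" for k
    proof (induction k)
      case (Suc k)
      let ?s = "replicate k False @ t"
      have "O' \<inter> E (True # ?s) = {}"
        using contr by (auto simp: ones_def)
      then have "O' \<inter> closure (E (True # ?s)) = {}"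
        using O'(1) by (simp add: open_Int_closure_eq_empty)
      then show ?case
        using Suc by (auto simp: E_simps(3))
    qed (use O' in auto)
    then have "B j \<inter> E (replicate (j - length t) False @ t) \<noteq> {}"
      using j by blast
    moreover let ?s = "replicate (j - length t) False @ t"
    have "length ?s = j"
      using j by simp
    ultimately have "E (True # ?s) \<subseteq> B j"
      using good_E[of ?s] unfolding good_def by simp
    then have "O' \<inter> E (True # ?s) \<noteq> {}"
      using j E(2)[of "True # ?s"] by blast
    moreover have "ones (True # ?s) = Suc (ones t)"
      by (simp add: ones_def)
    ultimately show False
      using contr by blast
  qed
  have dense: "O' \<inter> Q m \<noteq> {}" if O': "open O'" "O' \<noteq> {}" "O' \<subseteq> U" for O' m
  proof (induction m)
    case 0
    show ?case
      unfolding Q_def using O' by (auto simp: E_simps(1)[symmetric])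
  next
    case (Suc m)
    then obtain t where t: "m \<le> ones t" "O' \<inter> E t \<noteq> {}"
      unfolding Q_def by blast
    then obtain s where s: "ones s = Suc (ones t)" "O' \<inter> E t \<inter> E s \<noteq> {}"
      using step[of "O' \<inter> E t" t] open_Int[OF O'(1) E(1)[of t]] by blast
    then have "Suc m \<le> ones s"
      using t(1) by simp
    then show ?case
      unfolding Q_def using s(2) by blast
  qed
  have card_ones: "ones (bits a n) = card {i. i < n \<and> a i}" for a n
  proof (induction n)
    case (Suc n)
    have "{i. i < Suc n \<and> a i} = (if a n then insert n {i. i < n \<and> a i} else {i. i < n \<and> a i})"
      by (auto simp: less_Suc_eq)
    then show ?case
      using Suc by (simp add: ones_def)
  qed (simp add: ones_def)
  have H_eq: "e ` ?S = (\<Inter>m. Q m)"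
  proof (intro equalityI subsetI)
    fix x assume "x \<in> e ` ?S"
    then obtain a where a: "infinite {n. a n}" "x = e a"
      by blast
    have "\<exists>n. m \<le> ones (bits a n)" for m
    proof -
      obtain F where F: "F \<subseteq> {n. a n}" "card F = m" "finite F"
        using infinite_arbitrarily_large[OF a(1)] by metis
      then obtain n where "\<And>i. i \<in> F \<Longrightarrow> i < n"
        by (meson finite_nat_iff_bounded lessThan_iff subsetD)
      then have "F \<subseteq> {i. i < n \<and> a i}"
        using F by auto
      then have "m \<le> ones (bits a n)"
        unfolding card_ones F(2)[symmetric] by (intro card_mono) auto
      then show ?thesis ..
    qed
    then show "x \<in> (\<Inter>m. Q m)"
      using ed(2)[of a] a unfolding Q_def by auto
  next
    fix x assume x: "x \<in> (\<Inter>m. Q m)"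
    have "\<exists>t. length t = n \<and> x \<in> E t" for n
    proof -
      obtain s where s: "n \<le> ones s" "x \<in> E s"
        using x unfolding Q_def by blast
      \<comment> \<open>Dropping bits from the head climbs to ancestors, which gives a node around
        \<open>x\<close> at every smaller level.\<close>
      have drop: "x \<in> E (drop k s)" for k
      proof (induction k)
        case (Suc k)
        show ?case
        proof (cases "drop k s")
          case Nil
          then show ?thesis
            using Suc by (simp add: drop_Suc tl_drop)
        next
          case (Cons b t)
          then show ?thesis
            using Suc mono[of b t] by (auto simp: drop_Suc tl_drop[symmetric])
        qed
      qed (use s in simp)
      have "n \<le> length s"
        using s(1) unfolding ones_def by (meson length_filter_le order_trans)
      then show ?thesis
        using drop by (intro exI[of _ "drop (length s - n) s"]) auto
    qed
    then obtain t where t: "\<And>n. length (t n) = n" "\<And>n. x \<in> E (t n)"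
      by metis
    define a where "a n = hd (t (Suc n))" for n
    have bits_a: "bits a n = t n" for n
    proof (induction n)
      case (Suc n)
      obtain b s where bs: "t (Suc n) = b # s" "length s = n"
        using t(1)[of "Suc n"] by (metis length_Suc_conv)
      then have "x \<in> E s"
        using t(2)[of "Suc n"] mono by auto
      then have "s = t n"
        using scheme_same_level[of E s "t n" x, OF mono disj] t bs by simp
      then show ?case
        using Suc bs by (simp add: a_def)
    qed (use t(1)[of 0] in simp)
    \<comment> \<open>At each level only one node contains \<open>x\<close>, namely the initial
      segment of \<open>a\<close>; with finitely many \<open>True\<close> bits, \<open>x\<close>
      would lie in no \<open>Q m\<close> for large \<open>m\<close>.\<close>
    have "infinite {n. a n}"
    proof
      assume fin: "finite {n. a n}"
      let ?m = "Suc (card {n. a n})"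
      obtain s where s: "?m \<le> ones s" "x \<in> E s"
        using x unfolding Q_def by blast
      have "s = bits a (length s)"
        using scheme_same_level[of E s "t (length s)" x, OF mono disj] t bits_a s by simp
      moreover have "ones (bits a n) \<le> card {n. a n}" for n
      proof -
        have "ones (bits a n) = card {i. i < n \<and> a i}"
          by (rule card_ones)
        also have "\<dots> \<le> card {n. a n}"
          using fin by (intro card_mono) auto
        finally show ?thesis .
      qed
      ultimately have "ones s \<le> card {n. a n}"
        by metis
      then show False
        using s(1) by simp
    qed
    then show "x \<in> e ` ?S"
      using ed(3)[of a x] t(2) bits_a by auto
  qed
  show thesis
  proof (rule that[of "e ` ?S" e d])
    show "gdelta (e ` ?S)"
      unfolding H_eq by (rule gdelta.intros) (rule open_Q)
    show "homeomorphism ?S (e ` ?S) e d"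
      by (rule ed(1))
    have "meager (\<Union>m. U - Q m)"
      by (intro meager_UN_nat meager_complement_open_dense open_Q dense U)
    moreover have "U - e ` ?S = (\<Union>m. U - Q m)"
      unfolding H_eq by blast
    ultimately show "meager (U - e ` ?S)"
      by simp
    show "e ` ?S \<subseteq> U - M"
    proof
      fix x assume "x \<in> e ` ?S"
      then obtain a where a: "a \<in> ?S" "x = e a"
        by blast
      have "x \<in> U"
        using ed(2)[OF a(1), of 0] a(2) by (simp add: E_simps)
      \<comment> \<open>Every \<open>True\<close> bit at a position \<open>m\<close> puts
        \<open>x\<close> into \<open>D m\<close>, and such positions are unbounded.\<close>
      moreover have "x \<in> D n" for n
      proof -
        obtain m where m: "m \<ge> n" "a m"
          using a(1) unfolding infinite_nat_iff_unbounded_le by auto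
        then have "x \<in> D m"
          using ed(2)[OF a(1), of "Suc m"] a(2) good_E[of "bits a m"]
            closure_subset[of "E (True # bits a m)"]
          by (auto simp: good_def)
        then show ?thesis
          using lift_Suc_antimono_le[of D, OF D(2) m(1)] by blast
      qed
      ultimately show "x \<in> U - M"
        using D(3) by blast
    qed
  qed
qed

section \<open>Generic Cantor sets\<close>

lemma open_dense_rectangle:
  fixes D :: "('a::topological_space \<times> 'b::topological_space) set"
  assumes "open D" "\<And>O'. open O' \<Longrightarrow> O' \<noteq> {} \<Longrightarrow> O' \<inter> D \<noteq> {}"
    and "open A" "A \<noteq> {}" "open B" "B \<noteq> {}"
  obtains A' B' where "open A'" "A' \<noteq> {}" "A' \<subseteq> A" "open B'" "B' \<noteq> {}" "B' \<subseteq> B" "A' \<times> B' \<subseteq> D"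
proof -
  have "open (A \<times> B)" "A \<times> B \<noteq> {}"
    using assms by (auto simp: open_Times)
  then obtain z where "z \<in> A \<times> B \<inter> D"
    using assms(2) by blast
  moreover have "open (A \<times> B \<inter> D)"
    using \<open>open (A \<times> B)\<close> assms(1) by blast
  ultimately obtain A' B' where "open A'" "open B'" "z \<in> A' \<times> B'" "A' \<times> B' \<subseteq> A \<times> B \<inter> D"
    using open_prod_elim by metis
  then show thesis
    by (intro that[of A' B']) auto
qed

text \<open>Induction on \<open>T\<close>: a new index costs two further shrinkings of
  \<open>W\<close>, one for each child. The children found earlier remain valid, since shrinking
  \<open>W\<close> preserves their rectangle inclusions.\<close>

lemma split_finitely_many_open:
  fixes D :: "('a::topological_space \<times> 'b::{metric_space, perfect_space}) set"
  assumes D: "open D" "\<And>O'. open O' \<Longrightarrow> O' \<noteq> {} \<Longrightarrow> O' \<inter> D \<noteq> {}"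
    and "finite T" and v: "\<And>t. t \<in> T \<Longrightarrow> open (v t) \<and> v t \<noteq> {}"
    and O': "open O'" "O' \<noteq> {}" and \<epsilon>: "0 < \<epsilon>"
  shows "\<exists>W u. open W \<and> W \<noteq> {} \<and> W \<subseteq> O' \<and>
    (\<forall>t\<in>T. \<forall>b. open (u b t) \<and> u b t \<noteq> {} \<and> closure (u b t) \<subseteq> v t \<and> W \<times> u b t \<subseteq> D \<and>
       (\<forall>x\<in>u b t. \<forall>y\<in>u b t. dist x y \<le> \<epsilon>)) \<and>
    (\<forall>t\<in>T. u True t \<inter> u False t = {})"
  using \<open>finite T\<close> v
proof (induction T)
  case empty
  show ?case
    using O' by (intro exI[of _ O']) auto
next
  case (insert s T)
  then obtain W u where W: "open W" "W \<noteq> {}" "W \<subseteq> O'"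
    and u: "\<And>t b. t \<in> T \<Longrightarrow> open (u b t) \<and> u b t \<noteq> {} \<and> closure (u b t) \<subseteq> v t \<and> W \<times> u b t \<subseteq> D \<and>
       (\<forall>x\<in>u b t. \<forall>y\<in>u b t. dist x y \<le> \<epsilon>)" "\<And>t. t \<in> T \<Longrightarrow> u True t \<inter> u False t = {}"
    by (metis insertCI)
  obtain p where p: "p \<in> v s" "open (v s)"
    using insert.prems by blast
  then obtain q where q: "q \<in> v s" "q \<noteq> p"
    using open_perfect_other_point by metis
  obtain X Y where XY: "open X" "open Y" "p \<in> X" "q \<in> Y" "X \<inter> Y = {}"
    using hausdorff[of p q] q(2) by metis
  obtain P where P: "open P" "p \<in> P" "closure P \<subseteq> v s \<inter> X"
      "\<And>y z. y \<in> P \<Longrightarrow> z \<in> P \<Longrightarrow> dist y z \<le> \<epsilon>"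
    using obtain_small_open[of "v s \<inter> X" p \<epsilon>] p XY \<epsilon> by auto
  obtain Q where Q: "open Q" "q \<in> Q" "closure Q \<subseteq> v s \<inter> Y"
      "\<And>y z. y \<in> Q \<Longrightarrow> z \<in> Q \<Longrightarrow> dist y z \<le> \<epsilon>"
    using obtain_small_open[of "v s \<inter> Y" q \<epsilon>] p q XY \<epsilon> by auto
  obtain W1 P' where W1: "open W1" "W1 \<noteq> {}" "W1 \<subseteq> W" "open P'" "P' \<noteq> {}" "P' \<subseteq> P" "W1 \<times> P' \<subseteq> D"
    using open_dense_rectangle[OF D W(1,2) P(1)] P(2) by blast
  obtain W2 Q' where W2: "open W2" "W2 \<noteq> {}" "W2 \<subseteq> W1" "open Q'" "Q' \<noteq> {}" "Q' \<subseteq> Q" "W2 \<times> Q' \<subseteq> D"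
    using open_dense_rectangle[OF D W1(1,2) Q(1)] Q(2) by blast
  have cl: "closure P' \<subseteq> v s" "closure Q' \<subseteq> v s"
    using closure_mono[OF W1(6)] closure_mono[OF W2(6)] P(3) Q(3) by auto
  have disj: "P' \<inter> Q' = {}"
    using W1(6) W2(6) P(3) Q(3) XY(5) closure_subset[of P] closure_subset[of Q] by blast
  define u' where "u' b = (u b)(s := if b then P' else Q')" for b
  have "\<forall>t\<in>insert s T. \<forall>b. open (u' b t) \<and> u' b t \<noteq> {} \<and> closure (u' b t) \<subseteq> v t \<and> W2 \<times> u' b t \<subseteq> D \<and>
       (\<forall>x\<in>u' b t. \<forall>y\<in>u' b t. dist x y \<le> \<epsilon>)"
  proof (intro ballI allI)
    fix t b assume t: "t \<in> insert s T"
    show "open (u' b t) \<and> u' b t \<noteq> {} \<and> closure (u' b t) \<subseteq> v t \<and> W2 \<times> u' b t \<subseteq> D \<and>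
       (\<forall>x\<in>u' b t. \<forall>y\<in>u' b t. dist x y \<le> \<epsilon>)"
    proof (cases "t = s")
      case True
      have "W2 \<times> P' \<subseteq> D"
        using W1(7) W2(3) by blast
      moreover have "\<forall>x\<in>P'. \<forall>y\<in>P'. dist x y \<le> \<epsilon>" "\<forall>x\<in>Q'. \<forall>y\<in>Q'. dist x y \<le> \<epsilon>"
        using W1(6) P(4) W2(6) Q(4) by blast+
      ultimately show ?thesis
        using True W1(4,5) W2(4,5,7) cl by (cases b) (simp_all add: u'_def)
    next
      case False
      then have "t \<in> T" "u' b t = u b t"
        using t by (auto simp: u'_def)
      moreover from this have "W2 \<times> u b t \<subseteq> D"
        using u(1)[of t b] W1(3) W2(3) by blast
      ultimately show ?thesis
        using u(1)[of t b] by simp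
    qed
  qed
  moreover have "\<forall>t\<in>insert s T. u' True t \<inter> u' False t = {}"
    using disj u(2) by (auto simp: u'_def)
  moreover have "W2 \<subseteq> O'"
    using W(3) W1(3) W2(3) by blast
  ultimately show ?case
    using W2(1,2) by (intro exI[of _ W2] exI[of _ u']) blast
qed

lemma compact_UNIV_codes: "compact (UNIV :: (nat \<Rightarrow> bool) set)"
proof -
  have "compact_space (product_topology (\<lambda>i::nat. euclidean :: bool topology) UNIV)"
    by (subst compact_space_product_topology) (simp add: compact_space_def finite_imp_compact)
  then show ?thesis
    by (simp add: euclidean_product_topology compact_space_def)
qed

text \<open>
  Level \<open>k\<close> of the Cantor scheme \<open>V\<close> is shrunk so that a single nonempty open subset \<open>W k\<close> of the
  \<open>k\<close>-th basic open set satisfies \<open>W k \<times> V t \<subseteq> D k\<close> for all \<open>t\<close> of length \<open>k + 1\<close>; a generic point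
  lies in infinitely many \<open>W k\<close>.
\<close>

lemma generic_cantor_set:
  fixes M :: "('a::polish_space \<times> 'b::{polish_space, perfect_space}) set"
  assumes U: "open U" "U \<noteq> {}" and V: "open V" "V \<noteq> {}" and M: "meager M"
  obtains e H where "continuous_on UNIV e" "inj (e :: (nat \<Rightarrow> bool) \<Rightarrow> 'b)" "range e \<subseteq> V" "meager (range e)"
    "meager (U - H)" "H \<subseteq> U" "(H \<times> range e) \<inter> M = {}"
proof -
  \<comment> \<open>The horizontal lines over a countable dense set are added to \<open>M\<close>.
    Avoiding them makes the Cantor set miss \<open>S\<close>, so that it has empty interior.\<close>
  obtain S :: "'b set" where S: "countable S" "\<And>X. open X \<Longrightarrow> X \<noteq> {} \<Longrightarrow> \<exists>d\<in>S. d \<in> X"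
    using countable_dense_exists by metis
  have "meager (UNIV \<times> {s} :: ('a \<times> 'b) set)" for s
    by (rule meager_closed) (auto simp: closed_Times interior_Times)
  then have "meager (\<Union>s\<in>S. UNIV \<times> {s} :: ('a \<times> 'b) set)"
    by (intro meager_UN S)
  then have "meager (M \<union> (\<Union>s\<in>S. UNIV \<times> {s}))"
    using M by (intro meager_Un)
  then obtain D where D: "\<And>n. open (D n)" "\<And>n. D (Suc n) \<subseteq> D n"
    "(M \<union> (\<Union>s\<in>S. UNIV \<times> {s})) \<inter> (\<Inter>n. D n) = {}"
    "\<And>n O'. open O' \<Longrightarrow> O' \<noteq> {} \<Longrightarrow> O' \<inter> D n \<noteq> {}"
    by (rule meager_open_avoid) metis
  obtain B :: "nat \<Rightarrow> 'a set" where B: "\<And>n. open (B n)"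
    "\<And>O' n. open O' \<Longrightarrow> O' \<noteq> {} \<Longrightarrow> \<exists>k\<ge>n. B k \<noteq> {} \<and> B k \<subseteq> O'"
    using obtain_repeating_base by blast
  \<comment> \<open>A state pairs a family of open sets, of which stage \<open>k\<close> constrains
    only the members at lists of length \<open>k\<close>, with an open subset of the first
    factor.\<close>
  define level where "level k s \<longleftrightarrow> (\<forall>t. length t = k \<longrightarrow> open (fst s t) \<and> fst s t \<noteq> {} \<and> fst s t \<subseteq> V)"
    for k and s :: "(bool list \<Rightarrow> 'b set) \<times> 'a set"
  define next_level where "next_level k s s' \<longleftrightarrow> open (snd s') \<and> snd s' \<noteq> {} \<and> snd s' \<subseteq> U \<and>
      (B k \<inter> U \<noteq> {} \<longrightarrow> snd s' \<subseteq> B k) \<and>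
      (\<forall>t. length t = k \<longrightarrow>
        (\<forall>b. closure (fst s' (b # t)) \<subseteq> fst s t \<and> snd s' \<times> fst s' (b # t) \<subseteq> D k \<and>
          (\<forall>x\<in>fst s' (b # t). \<forall>y\<in>fst s' (b # t). dist x y \<le> (1/2) ^ k)) \<and>
        fst s' (True # t) \<inter> fst s' (False # t) = {})"
    for k and s s' :: "(bool list \<Rightarrow> 'b set) \<times> 'a set"
  have "\<exists>f. \<forall>n. level n (f n) \<and> next_level n (f n) (f (Suc n))"
  proof (rule dependent_nat_choice)
    show "\<exists>s. level 0 s"
      using V by (intro exI[of _ "(\<lambda>_. V, U)"]) (simp add: level_def)
  next
    fix s k assume s: "level k s"
    define O' where "O' = (if B k \<inter> U \<noteq> {} then B k \<inter> U else U)"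
    have O': "open O'" "O' \<noteq> {}" "O' \<subseteq> U" "B k \<inter> U \<noteq> {} \<Longrightarrow> O' \<subseteq> B k"
      using U B(1)[of k] by (auto simp: O'_def)
    let ?T = "{t :: bool list. length t = k}"
    have fin: "finite ?T"
      using finite_lists_length_eq[of "UNIV :: bool set" k] by simp
    have open_s: "\<And>t. t \<in> ?T \<Longrightarrow> open (fst s t) \<and> fst s t \<noteq> {}"
      using s by (auto simp: level_def)
    have pos: "0 < (1/2 :: real) ^ k"
      by simp
    have "\<exists>W u. open W \<and> W \<noteq> {} \<and> W \<subseteq> O' \<and>
        (\<forall>t\<in>?T. \<forall>b. open (u b t) \<and> u b t \<noteq> {} \<and> closure (u b t) \<subseteq> fst s t \<and> W \<times> u b t \<subseteq> D k \<and>
           (\<forall>x\<in>u b t. \<forall>y\<in>u b t. dist x y \<le> (1/2) ^ k)) \<and>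
        (\<forall>t\<in>?T. u True t \<inter> u False t = {})"
      by (rule split_finitely_many_open[OF D(1) D(4) fin open_s O'(1,2) pos])
    then obtain W u where W: "open W" "W \<noteq> {}" "W \<subseteq> O'"
      and u': "\<forall>t\<in>?T. \<forall>b. open (u b t) \<and> u b t \<noteq> {} \<and> closure (u b t) \<subseteq> fst s t \<and>
          W \<times> u b t \<subseteq> D k \<and> (\<forall>x\<in>u b t. \<forall>y\<in>u b t. dist x y \<le> (1/2) ^ k)"
        "\<forall>t\<in>?T. u True t \<inter> u False t = {}"
      by (elim exE conjE) (rule that)
    have u: "open (u b t) \<and> u b t \<noteq> {} \<and> closure (u b t) \<subseteq> fst s t \<and>
        W \<times> u b t \<subseteq> D k \<and> (\<forall>x\<in>u b t. \<forall>y\<in>u b t. dist x y \<le> (1/2) ^ k)"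
        "u True t \<inter> u False t = {}" if "length t = k" for t b
      using that u' by blast+
    define s' where "s' = (\<lambda>t. u (hd t) (tl t), W)"
    have "level (Suc k) s'"
      unfolding level_def
    proof (intro allI impI)
      fix t :: "bool list" assume "length t = Suc k"
      then have "length (tl t) = k"
        by simp
      then have "u (hd t) (tl t) \<subseteq> V"
        using u(1)[of "tl t" "hd t"] s closure_subset[of "u (hd t) (tl t)"]
        unfolding level_def by blast
      then show "open (fst s' t) \<and> fst s' t \<noteq> {} \<and> fst s' t \<subseteq> V"
        using u(1)[of "tl t" "hd t"] \<open>length (tl t) = k\<close> by (simp add: s'_def)
    qed
    moreover have "W \<subseteq> U" "B k \<inter> U \<noteq> {} \<longrightarrow> W \<subseteq> B k"
      using W(3) O'(3,4) by blast+
    then have "next_level k s s'"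
      unfolding next_level_def s'_def using W u by simp
    ultimately show "\<exists>s'. level (Suc k) s' \<and> next_level k s s'"
      by blast
  qed
  then obtain f where f: "\<And>n. level n (f n)" "\<And>n. next_level n (f n) (f (Suc n))"
    by blast
  \<comment> \<open>Each node set is read off at its own stage. The set \<open>W k\<close> arises in
    the passage from stage \<open>k\<close> to the next and is stored in the later state, hence the
    \<open>Suc\<close>.\<close>
  define C where "C t = fst (f (length t)) t" for t
  define W where "W k = snd (f (Suc k))" for k
  have C: "open (C t)" "C t \<noteq> {}" "C t \<subseteq> V" for t
    using f(1)[of "length t"] unfolding level_def C_def by auto
  have clC: "closure (C (b # t)) \<subseteq> C t" and WC: "W (length t) \<times> C (b # t) \<subseteq> D (length t)"
    and smallC: "\<forall>x\<in>C (b # t). \<forall>y\<in>C (b # t). dist x y \<le> (1/2) ^ length t"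
    and disjC: "C (True # t) \<inter> C (False # t) = {}" for b t
    using f(2)[of "length t"] unfolding next_level_def C_def W_def by simp_all
  have monoC: "C (b # t) \<subseteq> C t" for b t
    using clC[of b t] closure_subset[of "C (b # t)"] by blast
  have W: "open (W k)" "W k \<noteq> {}" "W k \<subseteq> U" "B k \<inter> U \<noteq> {} \<Longrightarrow> W k \<subseteq> B k" for k
    using f(2)[of k] unfolding next_level_def W_def by simp_all
  have small: "\<exists>m\<ge>n. closure (C (bits a (Suc m))) \<subseteq> C (bits a m) \<and>
          (\<forall>x\<in>C (bits a (Suc m)). \<forall>y\<in>C (bits a (Suc m)). dist x y \<le> (1/2) ^ m)" for a n
    using clC[of "a n" "bits a n"] smallC[of "a n" "bits a n"] by (intro exI[of _ n]) simp
  obtain e d where ed: "homeomorphism UNIV (range e) e d" "\<And>a n. e a \<in> C (bits a n)"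
    using scheme_homeomorphism[of C UNIV, OF C(1,2) monoC disjC small] by (metis UNIV_I)
  have cont: "continuous_on UNIV e" and inj: "inj e"
    using ed(1) by (auto simp: homeomorphism_def intro: inj_on_inverseI)
  define H where "H = (\<Inter>j. \<Union>k\<in>{j..}. W k)"
  have HU: "H \<subseteq> U"
    unfolding H_def using W(3) by blast
  have "meager (U - (\<Union>k\<in>{j..}. W k))" for j
  proof (rule meager_complement_open_dense)
    fix O' assume O': "open O'" "O' \<noteq> {}" "O' \<subseteq> U"
    then obtain k where k: "k \<ge> j" "B k \<noteq> {}" "B k \<subseteq> O'"
      using B(2) by metis
    then have "W k \<subseteq> O'"
      using W(4)[of k] O'(3) by blast
    then show "O' \<inter> (\<Union>k\<in>{j..}. W k) \<noteq> {}"
      using W(2)[of k] k(1) by blast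
  qed (use W U in auto)
  then have "meager (\<Union>j. U - (\<Union>k\<in>{j..}. W k))"
    by (rule meager_UN_nat)
  moreover have "U - H = (\<Union>j. U - (\<Union>k\<in>{j..}. W k))"
    unfolding H_def by blast
  ultimately have meagerH: "meager (U - H)"
    by simp
  \<comment> \<open>One index \<open>k \<ge> n\<close> with \<open>x \<in> W k\<close> suffices,
    because \<open>D\<close> decreases.\<close>
  have in_D: "(x, e a) \<in> D n" if x: "x \<in> H" for x a n
  proof -
    obtain k where k: "k \<ge> n" "x \<in> W k"
      using x unfolding H_def by blast
    then have "(x, e a) \<in> D k"
      using WC[of "bits a k" "a k"] ed(2)[of a "Suc k"] by auto
    then show ?thesis
      using lift_Suc_antimono_le[of D, OF D(2) k(1)] by blast
  qed
  then have avoid: "(H \<times> range e) \<inter> (M \<union> (\<Union>s\<in>S. UNIV \<times> {s})) = {}"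
    using D(3) by blast
  \<comment> \<open>Without a point of \<open>H\<close>, avoidance on the product would say nothing
    about \<open>range e\<close>; Baire category supplies one.\<close>
  have "H \<noteq> {}"
    using meagerH not_meager_open[OF U] by auto
  then have "range e \<inter> S = {}"
    using avoid by blast
  then have "interior (range e) = {}"
    using S(2)[OF open_interior] interior_subset by blast
  moreover have "closed (range e)"
    using compact_continuous_image[OF cont compact_UNIV_codes] compact_imp_closed by blast
  ultimately have "meager (range e)"
    by (intro meager_closed)
  moreover have "range e \<subseteq> V"
    using ed(2) C(3) by blast
  ultimately show thesis
    using that[OF cont inj _ _ meagerH HU] avoid by blast
qed

section \<open>Piecewise homeomorphisms\<close>

lemma gdelta_iff_gdelta_in: "gdelta S \<longleftrightarrow> gdelta_in euclidean S"
proof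
  assume "gdelta S"
  then obtain F :: "nat \<Rightarrow> 'a set" where "S = \<Inter>(range F)" "\<And>n. open (F n)"
    by (rule gdelta.cases) (rule that)
  moreover from this have "gdelta_in euclidean (\<Inter>(range F))"
    by (intro gdelta_in_Inter) (auto intro: open_imp_gdelta_in)
  ultimately show "gdelta_in euclidean S"
    by simp
next
  assume "gdelta_in euclidean S"
  then obtain C :: "nat \<Rightarrow> 'a set" where "\<And>n. open (C n)" "\<Inter>(range C) = S"
    unfolding gdelta_in_descending by auto
  then show "gdelta S"
    using gdelta.intros[of C] by simp
qed

lemma closed_imp_gdelta: "closed S \<Longrightarrow> gdelta (S :: 'a::metric_space set)"
  by (simp add: gdelta_iff_gdelta_in closed_imp_gdelta_in metrizable_space_euclidean)

lemma gdelta_Int: "gdelta S \<Longrightarrow> gdelta T \<Longrightarrow> gdelta (S \<inter> T)"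
  by (simp add: gdelta_iff_gdelta_in gdelta_in_Int)

lemma open_imp_gdelta: "open S \<Longrightarrow> gdelta S"
  by (simp add: gdelta_iff_gdelta_in open_imp_gdelta_in)

lemma gdelta_Diff_countable:
  fixes S :: "'a::metric_space set"
  assumes "gdelta S" "countable Q"
  shows "gdelta (S - Q)"
proof -
  have "fsigma_in euclidean (\<Union>q\<in>Q. {q})"
    using assms(2) by (intro fsigma_in_Union) (auto intro: closed_imp_fsigma_in)
  then show ?thesis
    using assms(1) by (simp add: gdelta_iff_gdelta_in gdelta_in_diff)
qed

text \<open>Disjointness of the open sets \<open>U i\<close> lets the union commute with the
  countable intersections: a point of \<open>U i\<close> can only be covered through the index
  \<open>i\<close>.\<close>

lemma gdelta_UN_disjoint:
  fixes H U :: "'i \<Rightarrow> 'a::topological_space set"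
  assumes H: "\<And>i. i \<in> I \<Longrightarrow> gdelta (H i)" "\<And>i. i \<in> I \<Longrightarrow> H i \<subseteq> U i"
    and U: "\<And>i. i \<in> I \<Longrightarrow> open (U i)" "disjoint_family_on U I"
  shows "gdelta (\<Union>i\<in>I. H i)"
proof -
  have "\<exists>T :: nat \<Rightarrow> 'a set. (\<forall>n. open (T n)) \<and> H i = \<Inter>(range T)" if i: "i \<in> I" for i
    by (rule gdelta.cases[OF H(1)[OF i]]) blast
  then obtain T where T: "\<And>i n. i \<in> I \<Longrightarrow> open (T i n :: 'a set)" "\<And>i. i \<in> I \<Longrightarrow> H i = (\<Inter>n::nat. T i n)"
    by metis
  have "(\<Union>i\<in>I. H i) = (\<Inter>n. \<Union>i\<in>I. U i \<inter> T i n)"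
  proof (intro equalityI subsetI)
    fix x assume x: "x \<in> (\<Inter>n. \<Union>i\<in>I. U i \<inter> T i n)"
    then obtain i where i: "i \<in> I" "x \<in> U i"
      by blast
    have "x \<in> T i n" for n
    proof -
      obtain j where "j \<in> I" "x \<in> U j \<inter> T j n"
        using x by blast
      then show ?thesis
        using i U(2) by (cases "i = j") (auto simp: disjoint_family_on_def)
    qed
    then show "x \<in> (\<Union>i\<in>I. H i)"
      using i T(2) by blast
  next
    fix x assume "x \<in> (\<Union>i\<in>I. H i)"
    then obtain i where i: "i \<in> I" "x \<in> H i"
      by blast
    then have "x \<in> U i \<inter> T i n" for n
      using H(2)[OF i(1)] T(2)[OF i(1)] by blast
    then show "x \<in> (\<Inter>n. \<Union>i\<in>I. U i \<inter> T i n)"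
      using i(1) by blast
  qed
  moreover have "open (\<Union>i\<in>I. U i \<inter> T i n)" for n
    using U(1) T(1) by (intro open_UN ballI open_Int) simp_all
  then have "gdelta (\<Inter>n. \<Union>i\<in>I. U i \<inter> T i n)"
    by (rule gdelta.intros)
  ultimately show ?thesis
    by simp
qed

text \<open>In a metric space this is the class \<Sigma>\<open>\<^sup>0\<^sub>3\<close>. A countable
  family, rather than a sequence, treats empty and finite unions uniformly.\<close>

definition gdelta_sigma :: "'a::topological_space set \<Rightarrow> bool" where
  "gdelta_sigma S \<longleftrightarrow> (\<exists>\<G>. countable \<G> \<and> (\<forall>G\<in>\<G>. gdelta G) \<and> S = \<Union>\<G>)"

lemma gdelta_sigma_gdelta: "gdelta S \<Longrightarrow> gdelta_sigma S"
  unfolding gdelta_sigma_def by (intro exI[of _ "{S}"]) simp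

lemma gdelta_sigma_countable:
  fixes S :: "'a::metric_space set"
  assumes "countable S"
  shows "gdelta_sigma S"
  unfolding gdelta_sigma_def
  by (intro exI[of _ "(\<lambda>x. {x}) ` S"]) (use assms in \<open>auto intro: closed_imp_gdelta\<close>)

lemma gdelta_sigma_UN:
  assumes "countable I" "\<And>i. i \<in> I \<Longrightarrow> gdelta_sigma (S i)"
  shows "gdelta_sigma (\<Union>i\<in>I. S i)"
proof -
  obtain \<G> where "\<And>i. i \<in> I \<Longrightarrow> countable (\<G> i) \<and> (\<forall>G\<in>\<G> i. gdelta G) \<and> S i = \<Union>(\<G> i)"
    using assms(2) unfolding gdelta_sigma_def by metis
  then show ?thesis
    unfolding gdelta_sigma_def by (intro exI[of _ "\<Union>i\<in>I. \<G> i"]) (use assms(1) in auto)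
qed

lemma gdelta_sigma_Int_open:
  assumes "gdelta_sigma S" "open W"
  shows "gdelta_sigma (S \<inter> W)"
proof -
  obtain \<G> where \<G>: "countable \<G>" "\<And>G. G \<in> \<G> \<Longrightarrow> gdelta G" "S = \<Union>\<G>"
    using assms(1) unfolding gdelta_sigma_def by blast
  have "gdelta_sigma (\<Union>G\<in>\<G>. G \<inter> W)"
    by (intro gdelta_sigma_UN gdelta_sigma_gdelta gdelta_Int \<G> open_imp_gdelta[OF assms(2)])
  then show ?thesis
    using \<G>(3) by simp
qed

text \<open>Traces of open sets have level 1, so the relative complement of a \<open>G_delta\<close>
  set has level 2, and a countable union of complements of these has level 3.\<close>

lemma Sigma0_3_gdelta_sigma:
  assumes "gdelta_sigma S"
  shows "Sigma0 (top_of_set F) 3 (F \<inter> S)"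
proof -
  have two: "Sigma0 (top_of_set F) 2 (F - G)" if G: "gdelta G" for G
  proof -
    obtain T :: "nat \<Rightarrow> 'a set" where T: "G = \<Inter>(range T)" "\<And>n. open (T n)"
      by (rule gdelta.cases[OF G]) (rule that)
    have "Sigma0 (top_of_set F) 2 (\<Union>i. topspace (top_of_set F) - F \<inter> T i)"
    proof (rule Sigma0_Union)
      show "1 < (2::nat) \<and> Sigma0 (top_of_set F) 1 (F \<inter> T i)" for i
        using Sigma0_open[of "top_of_set F" "F \<inter> T i"] T(2) by (auto intro: openin_open_Int)
    qed
    moreover have "(\<Union>i. topspace (top_of_set F) - F \<inter> T i) = F - G"
      using T(1) by auto
    ultimately show ?thesis
      by simp
  qed
  obtain \<G> where \<G>: "countable \<G>" "\<And>G. G \<in> \<G> \<Longrightarrow> gdelta G" "S = \<Union>\<G>"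
    using assms unfolding gdelta_sigma_def by blast
  \<comment> \<open>Inserting the empty set guarantees a nonempty family to enumerate and leaves the
    union unchanged.\<close>
  define g where "g = from_nat_into (insert {} \<G>)"
  have g: "range g = insert {} \<G>"
    unfolding g_def using \<G>(1) by (intro range_from_nat_into) auto
  have "gdelta (g i)" for i
    using rangeI[of g i] \<G>(2) unfolding g by (auto intro: open_imp_gdelta)
  then have "Sigma0 (top_of_set F) 3 (\<Union>i. topspace (top_of_set F) - (F - g i))"
    using two by (intro Sigma0_Union[of "\<lambda>_. 2"]) simp
  moreover have "(\<Union>i. topspace (top_of_set F) - (F - g i)) = F \<inter> (\<Union>(range g))"
    by auto
  moreover have "\<Union>(range g) = S"
    unfolding g \<G>(3) by simp
  ultimately show ?thesis
    by simp
qed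

section \<open>Calculus of piecewise homeomorphisms\<close>

text \<open>Pieces and their images are both \<open>G_delta_sigma\<close> in the whole spaces, which
  makes the notion symmetric under inversion. The pieces may overlap.\<close>

definition piecewise_homeo ::
    "'a::topological_space set \<Rightarrow> 'b::topological_space set \<Rightarrow> ('a \<Rightarrow> 'b) \<Rightarrow> bool" where
  "piecewise_homeo F G f \<longleftrightarrow> bij_betw f F G \<and>
     (\<exists>\<S>. countable \<S> \<and> \<Union>\<S> = F \<and>
        (\<forall>S\<in>\<S>. gdelta_sigma S \<and> gdelta_sigma (f ` S) \<and> (\<exists>g. homeomorphism S (f ` S) f g)))"

lemma piecewise_homeo_inv_into:
  assumes "piecewise_homeo F G f"
  shows "piecewise_homeo G F (inv_into F f)"
proof -
  obtain \<S> where bij: "bij_betw f F G" and \<S>: "countable \<S>" "\<Union>\<S> = F"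
    and S: "\<And>S. S \<in> \<S> \<Longrightarrow> gdelta_sigma S \<and> gdelta_sigma (f ` S) \<and> (\<exists>g. homeomorphism S (f ` S) f g)"
    using assms unfolding piecewise_homeo_def by blast
  let ?g = "inv_into F f"
  have "gdelta_sigma (f ` S) \<and> gdelta_sigma (?g ` f ` S) \<and> (\<exists>h. homeomorphism (f ` S) (?g ` f ` S) ?g h)"
    if SS: "S \<in> \<S>" for S
  proof -
    have "S \<subseteq> F"
      using SS \<S>(2) by blast
    then have gf: "?g (f x) = x" if "x \<in> S" for x
      using that bij by (auto simp: bij_betw_def inv_into_f_f)
    then have img: "?g ` f ` S = S"
      by force
    obtain h where h: "homeomorphism S (f ` S) f h"
      using S[OF SS] by blast
    have "homeomorphism (f ` S) S ?g f"
    proof (rule homeomorphism_cong[OF _ refl refl])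
      show "homeomorphism (f ` S) S h f"
        using h by (rule homeomorphism_symD)
    qed (use gf h in \<open>auto simp: homeomorphism_def\<close>)
    then show ?thesis
      unfolding img using S[OF SS] by blast
  qed
  moreover have "\<Union>((`) f ` \<S>) = G"
    using bij \<S>(2) by (auto simp: bij_betw_def)
  ultimately show ?thesis
    unfolding piecewise_homeo_def using bij \<S>(1)
    by (intro conjI bij_betw_inv_into exI[of _ "(`) f ` \<S>"]) auto
qed

text \<open>On a piece, the preimage of an open set is the trace of an open set, hence again
  \<open>G_delta_sigma\<close>; countably many pieces are then united.\<close>

lemma piecewise_homeo_baire_class_two:
  assumes "piecewise_homeo F G f"
  shows "baire_class_two (top_of_set F) (top_of_set G) f"
proof -
  obtain \<S> where bij: "bij_betw f F G" and \<S>: "countable \<S>" "\<Union>\<S> = F"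
    and S: "\<And>S. S \<in> \<S> \<Longrightarrow> gdelta_sigma S \<and> gdelta_sigma (f ` S) \<and> (\<exists>g. homeomorphism S (f ` S) f g)"
    using assms unfolding piecewise_homeo_def by blast
  have "Sigma0 (top_of_set F) 3 {x \<in> F. f x \<in> U}" if U: "openin (top_of_set G) U" for U
  proof -
    obtain W where W: "open W" "U = G \<inter> W"
      using U by (auto simp: openin_open)
    have "gdelta_sigma (S \<inter> f -` W)" if SS: "S \<in> \<S>" for S
    proof -
      have "continuous_on S f"
        using S[OF SS] by (auto simp: homeomorphism_def)
      then obtain A where "open A" "A \<inter> S = f -` W \<inter> S"
        using W(1) unfolding continuous_on_open_invariant by blast
      then show ?thesis
        using S[OF SS] gdelta_sigma_Int_open[of S A] by (simp add: Int_commute)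
    qed
    then have "gdelta_sigma (\<Union>S\<in>\<S>. S \<inter> f -` W)"
      using \<S>(1) by (intro gdelta_sigma_UN)
    then have "Sigma0 (top_of_set F) 3 (F \<inter> (\<Union>S\<in>\<S>. S \<inter> f -` W))"
      by (rule Sigma0_3_gdelta_sigma)
    moreover have "F \<inter> (\<Union>S\<in>\<S>. S \<inter> f -` W) = {x \<in> F. f x \<in> U}"
      using \<S>(2) W(2) bij by (auto simp: bij_betw_def)
    ultimately show ?thesis
      by simp
  qed
  then show ?thesis
    unfolding baire_class_two_def using bij by (auto simp: bij_betw_def)
qed

lemma piecewise_homeo_second_class_iso:
  assumes "piecewise_homeo F G f"
  shows "second_class_iso F G f"
  unfolding second_class_iso_def
  using assms piecewise_homeo_baire_class_two[OF assms]
    piecewise_homeo_baire_class_two[OF piecewise_homeo_inv_into[OF assms]]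
  by (simp add: piecewise_homeo_def)

lemma piecewise_homeo_homeomorphism:
  assumes "homeomorphism S T f g" "gdelta_sigma S" "gdelta_sigma T"
  shows "piecewise_homeo S T f"
proof -
  have "f ` S = T" "inj_on f S"
    using assms(1) by (auto simp: homeomorphism_def intro: inj_on_inverseI)
  then show ?thesis
    unfolding piecewise_homeo_def bij_betw_def using assms by (intro conjI exI[of _ "{S}"]) auto
qed

text \<open>With singletons as pieces, any bijection between countable sets qualifies, however
  discontinuous.\<close>

lemma piecewise_homeo_countable:
  fixes F :: "'a::metric_space set" and G :: "'b::metric_space set"
  assumes "bij_betw f F G" "countable F"
  shows "piecewise_homeo F G f"
proof -
  have "homeomorphism {x} (f ` {x}) f (\<lambda>_. x)" for x
    by (simp add: homeomorphism_def)
  then have "\<forall>S\<in>(\<lambda>x. {x}) ` F. gdelta_sigma S \<and> gdelta_sigma (f ` S) \<and> (\<exists>g. homeomorphism S (f ` S) f g)"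
    by (auto intro!: gdelta_sigma_countable)
  then show ?thesis
    unfolding piecewise_homeo_def using assms by (intro conjI exI[of _ "(\<lambda>x. {x}) ` F"]) auto
qed

lemma piecewise_homeo_cong:
  assumes "piecewise_homeo F G f" "\<And>x. x \<in> F \<Longrightarrow> f x = g x"
  shows "piecewise_homeo F G g"
proof -
  obtain \<S> where bij: "bij_betw f F G" and \<S>: "countable \<S>" "\<Union>\<S> = F"
    and S: "\<And>S. S \<in> \<S> \<Longrightarrow> gdelta_sigma S \<and> gdelta_sigma (f ` S) \<and> (\<exists>h. homeomorphism S (f ` S) f h)"
    using assms(1) unfolding piecewise_homeo_def by blast
  have "gdelta_sigma S \<and> gdelta_sigma (g ` S) \<and> (\<exists>h. homeomorphism S (g ` S) g h)" if SS: "S \<in> \<S>" for S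
  proof -
    have eq: "f x = g x" if "x \<in> S" for x
      using that SS \<S>(2) assms(2) by blast
    then have img: "g ` S = f ` S"
      by force
    obtain h where h: "homeomorphism S (f ` S) f h"
      using S[OF SS] by blast
    have "homeomorphism S (f ` S) g h"
      by (rule homeomorphism_cong[OF h refl refl]) (use eq in auto)
    then show ?thesis
      unfolding img using S[OF SS] by blast
  qed
  moreover have "bij_betw g F G"
    using bij bij_betw_cong[of F f g G] assms(2) by simp
  ultimately show ?thesis
    unfolding piecewise_homeo_def using \<S> by (intro conjI exI[of _ \<S>]) simp_all
qed

text \<open>Disjoint domains make the glued map well defined and disjoint targets make it injective;
  the countably many families of pieces are pooled.\<close>

lemma piecewise_homeo_UN:
  assumes I: "countable I" and pw: "\<And>i. i \<in> I \<Longrightarrow> piecewise_homeo (F i) (G i) (f i)"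
    and disj: "disjoint_family_on F I" "disjoint_family_on G I"
  obtains g where "piecewise_homeo (\<Union>i\<in>I. F i) (\<Union>i\<in>I. G i) g" "\<And>i x. i \<in> I \<Longrightarrow> x \<in> F i \<Longrightarrow> g x = f i x"
proof -
  define g where "g x = f (SOME i. i \<in> I \<and> x \<in> F i) x" for x
  have g: "g x = f i x" if "i \<in> I" "x \<in> F i" for i x
  proof -
    have "(SOME i. i \<in> I \<and> x \<in> F i) = i"
      using that disj(1) by (intro some_equality) (auto simp: disjoint_family_on_def)
    then show ?thesis
      by (simp add: g_def)
  qed
  have pwg: "piecewise_homeo (F i) (G i) g" if "i \<in> I" for i
    by (rule piecewise_homeo_cong[OF pw[OF that]]) (simp add: g[OF that])
  have "bij_betw g (\<Union>i\<in>I. F i) (\<Union>i\<in>I. G i)"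
    using pwg by (intro bij_betw_UNION_disjoint disj(2)) (simp add: piecewise_homeo_def)
  moreover have "\<forall>i\<in>I. \<exists>\<S>. countable \<S> \<and> \<Union>\<S> = F i \<and>
        (\<forall>S\<in>\<S>. gdelta_sigma S \<and> gdelta_sigma (g ` S) \<and> (\<exists>h. homeomorphism S (g ` S) g h))"
    using pwg unfolding piecewise_homeo_def by blast
  then obtain \<S> where \<S>: "\<forall>i\<in>I. countable (\<S> i) \<and> \<Union>(\<S> i) = F i \<and>
        (\<forall>S\<in>\<S> i. gdelta_sigma S \<and> gdelta_sigma (g ` S) \<and> (\<exists>h. homeomorphism S (g ` S) g h))"
    by (rule bchoice[THEN exE])
  moreover have "countable (\<Union>i\<in>I. \<S> i)"
    using I \<S> by simp
  moreover have "\<Union>(\<Union>i\<in>I. \<S> i) = (\<Union>i\<in>I. \<Union>(\<S> i))"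
    by blast
  then have "\<Union>(\<Union>i\<in>I. \<S> i) = (\<Union>i\<in>I. F i)"
    using \<S> by simp
  ultimately have "piecewise_homeo (\<Union>i\<in>I. F i) (\<Union>i\<in>I. G i) g"
    unfolding piecewise_homeo_def by (intro conjI exI[of _ "\<Union>i\<in>I. \<S> i"]) auto
  then show thesis
    using g by (rule that)
qed

lemma piecewise_homeo_Un:
  assumes "piecewise_homeo F G f" "piecewise_homeo F' G' f'" "F \<inter> F' = {}" "G \<inter> G' = {}"
  shows "piecewise_homeo (F \<union> F') (G \<union> G') (\<lambda>x. if x \<in> F then f x else f' x)"
proof -
  obtain g where g: "piecewise_homeo (\<Union>b\<in>UNIV. if b then F else F') (\<Union>b\<in>UNIV. if b then G else G') g"
      "\<And>b x. b \<in> UNIV \<Longrightarrow> x \<in> (if b then F else F') \<Longrightarrow> g x = (if b then f else f') x"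
    by (rule piecewise_homeo_UN[of UNIV "\<lambda>b. if b then F else F'" "\<lambda>b. if b then G else G'"
          "\<lambda>b. if b then f else f'"])
      (use assms in \<open>auto simp: disjoint_family_on_def\<close>)
  have "piecewise_homeo (F \<union> F') (G \<union> G') g"
    using g(1) by (simp add: UNIV_bool Un_commute)
  then show ?thesis
    by (rule piecewise_homeo_cong) (use g(2)[of True] g(2)[of False] assms(3) in auto)
qed

section \<open>Families of generic Cantor sets\<close>

lemma countable_finite_codes: "countable {a. finite {n::nat. a n}}"
proof -
  have "{a. finite {n::nat. a n}} \<subseteq> (\<lambda>A n. n \<in> A) ` {A. finite A}"
  proof
    fix a :: "nat \<Rightarrow> bool" assume "a \<in> {a. finite {n. a n}}"
    then show "a \<in> (\<lambda>A n. n \<in> A) ` {A. finite A}"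
      by (intro image_eqI[of _ _ "{n. a n}"]) auto
  qed
  then show ?thesis
    using countable_Collect_finite countable_image countable_subset by blast
qed

lemma infinite_finite_codes: "infinite {a. finite {n::nat. a n}}"
proof
  assume "finite {a. finite {n::nat. a n}}"
  moreover have "range (\<lambda>k n. n = k) \<subseteq> {a. finite {n::nat. a n}}"
    by auto
  ultimately have "finite (range (\<lambda>k n::nat. n = k))"
    by (rule rev_finite_subset)
  moreover have "inj (\<lambda>k n::nat. n = k)"
    by (rule injI) (metis (full_types))
  ultimately show False
    using finite_imageD infinite_UNIV_nat by blast
qed

text \<open>
  The codes with only finitely many \<open>True\<close> are not reached by the homeomorphic copy \<open>H\<close> of the other
  codes; they are matched with a countable set \<open>C\<close> of further points.
\<close>

lemma piecewise_homeo_onto_cantor_set: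
  fixes U H\<^sub>0 Z :: "'a::{polish_space, perfect_space} set" and e :: "(nat \<Rightarrow> bool) \<Rightarrow> 'b::metric_space"
  assumes U: "open U" "U \<noteq> {}" "meager (U - H\<^sub>0)" and Z: "meager Z"
    and e: "continuous_on UNIV e" "inj e"
  obtains H C f where "gdelta H" "countable C" "H \<union> C \<subseteq> U \<inter> H\<^sub>0 - Z" "meager (U - H)"
    "piecewise_homeo (H \<union> C) (range e) f"
proof -
  let ?fin = "{a. finite {n::nat. a n}}" and ?inf = "{a. infinite {n::nat. a n}}"
  define M where "M = (U - H\<^sub>0) \<union> Z"
  have M: "meager M"
    unfolding M_def using U(3) Z by (rule meager_Un)
  \<comment> \<open>In a perfect space finite sets are meager, so a finite \<open>U - M\<close>
    would make the nonempty open set \<open>U\<close> meager.\<close>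
  have "infinite (U - M)"
  proof
    assume "finite (U - M)"
    then have "meager ((U - M) \<union> M)"
      by (rule meager_Un[OF meager_countable[OF countable_finite] M])
    then show False
      using meager_subset[of "(U - M) \<union> M" U] not_meager_open[OF U(1,2)] by blast
  qed
  \<comment> \<open>\<open>C\<close> is set aside first; being meager, it can be avoided by the
    generic set \<open>H\<close> found next.\<close>
  then obtain C where C: "C \<subseteq> U - M" "infinite C" "countable C"
    using infinite_countable_subset' by metis
  have "meager (M \<union> C)"
    by (rule meager_Un[OF M meager_countable[OF C(3)]])
  then obtain H h d where H: "gdelta H" "H \<subseteq> U - (M \<union> C)" "meager (U - H)" "homeomorphism ?inf H h d"
    using generic_set_homeomorphic_infinite_codes[OF U(1,2)] by metis
  obtain e' where e': "homeomorphism UNIV (range e) e e'"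
    using homeomorphism_compact[OF compact_UNIV_codes e(1) refl e(2)] by blast
  have "homeomorphism ?inf (e ` ?inf) e e'"
    by (rule homeomorphism_of_subsets[OF e']) auto
  then have homeo: "homeomorphism H (e ` ?inf) (e \<circ> d) (h \<circ> e')"
    using homeomorphism_compose[OF homeomorphism_symD[OF H(4)]] by blast
  have cfin: "countable (e ` ?fin)"
    using countable_finite_codes by (rule countable_image)
  have "e ` ?inf = range e - e ` ?fin"
    using e(2) by (auto dest: injD)
  moreover have "gdelta (range e - e ` ?fin)"
    using compact_continuous_image[OF e(1) compact_UNIV_codes] cfin
    by (intro gdelta_Diff_countable closed_imp_gdelta compact_imp_closed)
  ultimately have pw1: "piecewise_homeo H (e ` ?inf) (e \<circ> d)"
    using homeo H(1) by (intro piecewise_homeo_homeomorphism gdelta_sigma_gdelta) simp_all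
  have "infinite (e ` ?fin)"
    using infinite_finite_codes e(2) finite_imageD inj_on_subset subset_UNIV by metis
  \<comment> \<open>Both sets are countably infinite, so they are matched through their
    enumerations.\<close>
  then have "bij_betw (from_nat_into (e ` ?fin) \<circ> to_nat_on C) C (e ` ?fin)"
    using C cfin by (intro bij_betw_trans[OF to_nat_on_infinite bij_betw_from_nat_into])
  then have pw2: "piecewise_homeo C (e ` ?fin) (from_nat_into (e ` ?fin) \<circ> to_nat_on C)"
    using C(3) by (rule piecewise_homeo_countable)
  have "H \<inter> C = {}"
    using H(2) by blast
  moreover have "e ` ?inf \<inter> e ` ?fin = {}"
    using e(2) by (auto dest: injD)
  moreover have "e ` ?inf \<union> e ` ?fin = range e"
    by auto
  ultimately have "\<exists>f. piecewise_homeo (H \<union> C) (range e) f"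
    using piecewise_homeo_Un[OF pw1 pw2] by metis
  moreover have "H \<union> C \<subseteq> U \<inter> H\<^sub>0 - Z"
    using H(2) C(1) unfolding M_def by blast
  ultimately show thesis
    using that[OF H(1) C(3) _ H(3)] by blast
qed

section \<open>Disjoint rectangles and disjoint Cantor sets\<close>

text \<open>Basic rectangles inside \<open>W\<close> are enumerated and the closure of the earlier
  first sides is subtracted, which keeps the sets open. The union stays dense: the first side that
  meets a given open set \<open>O'\<close> loses no point of \<open>O'\<close>.\<close>

lemma disjoint_rectangles:
  fixes W :: "('a::second_countable_topology \<times> 'b::second_countable_topology) set"
  assumes W: "open W" and proj: "\<And>O'. open O' \<Longrightarrow> O' \<noteq> {} \<Longrightarrow> \<exists>x\<in>O'. \<exists>y. (x, y) \<in> W"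
  obtains I :: "nat set" and U V
  where "\<And>n. n \<in> I \<Longrightarrow> open (U n) \<and> U n \<noteq> {}" "\<And>n. n \<in> I \<Longrightarrow> open (V n) \<and> V n \<noteq> {}"
    "\<And>n. n \<in> I \<Longrightarrow> U n \<times> V n \<subseteq> W" "disjoint_family_on U I" "meager (- (\<Union>n\<in>I. U n))"
proof -
  obtain A :: "nat \<Rightarrow> 'a set" where A: "\<And>n. open (A n)"
    "\<And>O' n. open O' \<Longrightarrow> O' \<noteq> {} \<Longrightarrow> \<exists>k\<ge>n. A k \<noteq> {} \<and> A k \<subseteq> O'"
    using obtain_repeating_base by blast
  obtain B :: "nat \<Rightarrow> 'b set" where B: "\<And>n. open (B n)"
    "\<And>O' n. open O' \<Longrightarrow> O' \<noteq> {} \<Longrightarrow> \<exists>k\<ge>n. B k \<noteq> {} \<and> B k \<subseteq> O'"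
    using obtain_repeating_base by blast
  define p where "p n = A (fst (prod_decode n))" for n
  define V where "V n = B (snd (prod_decode n))" for n
  define J where "J = {n. V n \<noteq> {} \<and> p n \<times> V n \<subseteq> W}"
  define U where "U n = p n - closure (\<Union>i\<in>{i\<in>J. i < n}. p i)" for n
  define I where "I = {n\<in>J. U n \<noteq> {}}"
  have open_U: "open (U n)" for n
    unfolding U_def p_def using A(1) by (intro open_Diff) auto
  have disj_less: "U m \<inter> U n = {}" if "m \<in> I" "m < n" for m n
  proof -
    have "p m \<subseteq> closure (\<Union>i\<in>{i\<in>J. i < n}. p i)"
      using that closure_subset[of "\<Union>i\<in>{i\<in>J. i < n}. p i"] unfolding I_def by blast
    then show ?thesis
      unfolding U_def by blast
  qed
  have "disjoint_family_on U I"
    unfolding disjoint_family_on_def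
  proof (intro ballI impI)
    fix m n assume "m \<in> I" "n \<in> I" "m \<noteq> n"
    then show "U m \<inter> U n = {}"
      using disj_less[of m n] disj_less[of n m] by (cases m n rule: linorder_cases) auto
  qed
  moreover have "meager (UNIV - (\<Union>n\<in>I. U n))"
  proof (rule meager_complement_open_dense)
    show "open (\<Union>n\<in>I. U n)"
      using open_U by blast
    fix O' :: "'a set" assume O': "open O'" "O' \<noteq> {}"
    obtain x y where xy: "x \<in> O'" "(x, y) \<in> W"
      using proj[OF O'] by blast
    obtain P Q where PQ: "open P" "open Q" "(x, y) \<in> P \<times> Q" "P \<times> Q \<subseteq> W"
      by (rule open_prod_elim[OF W xy(2)])
    obtain a where a: "A a \<noteq> {}" "A a \<subseteq> P \<inter> O'"
      using A(2)[OF open_Int[OF PQ(1) O'(1)], of 0] PQ(3) xy(1) by blast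
    obtain b where b: "B b \<noteq> {}" "B b \<subseteq> Q"
      using B(2)[OF PQ(2), of 0] PQ(3) by blast
    have "prod_encode (a, b) \<in> J \<and> O' \<inter> p (prod_encode (a, b)) \<noteq> {}"
      using a b PQ(4) unfolding J_def p_def V_def by auto
    then have ex: "\<exists>n. n \<in> J \<and> O' \<inter> p n \<noteq> {}"
      by blast
    define n where "n = (LEAST n. n \<in> J \<and> O' \<inter> p n \<noteq> {})"
    have n: "n \<in> J" "O' \<inter> p n \<noteq> {}"
      using LeastI_ex[OF ex] unfolding n_def by blast+
    have "O' \<inter> p i = {}" if "i \<in> J" "i < n" for i
      using not_less_Least[of i "\<lambda>n. n \<in> J \<and> O' \<inter> p n \<noteq> {}"] that unfolding n_def by blast
    then have "O' \<inter> (\<Union>i\<in>{i\<in>J. i < n}. p i) = {}"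
      by blast
    then have "O' \<inter> closure (\<Union>i\<in>{i\<in>J. i < n}. p i) = {}"
      using O'(1) by (simp add: open_Int_closure_eq_empty)
    then have "O' \<inter> U n \<noteq> {}"
      using n(2) unfolding U_def by blast
    moreover from this have "n \<in> I"
      using n(1) unfolding I_def by blast
    ultimately show "O' \<inter> (\<Union>n\<in>I. U n) \<noteq> {}"
      by blast
  qed simp
  then have "meager (- (\<Union>n\<in>I. U n))"
    by (simp add: Compl_eq_Diff_UNIV)
  moreover have "open (U n) \<and> U n \<noteq> {}" "open (V n) \<and> V n \<noteq> {}" "U n \<times> V n \<subseteq> W" if "n \<in> I" for n
    using that open_U B(1) unfolding I_def J_def U_def V_def by auto
  ultimately show thesis
    by (intro that[of I U V])
qed

text \<open>Data for one half of the construction. The inclusion of the products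
  \<open>H n \<times> range (e n)\<close> in a given set is kept apart, as the map is built from
  these data alone.\<close>

definition cantor_family ::
    "nat set \<Rightarrow> (nat \<Rightarrow> 'a::topological_space set) \<Rightarrow> (nat \<Rightarrow> 'a set) \<Rightarrow>
     (nat \<Rightarrow> (nat \<Rightarrow> bool) \<Rightarrow> 'b::topological_space) \<Rightarrow> bool" where
  "cantor_family I U H e \<longleftrightarrow>
     (\<forall>n\<in>I. open (U n) \<and> U n \<noteq> {} \<and> meager (U n - H n) \<and>
        continuous_on UNIV (e n) \<and> inj (e n) \<and> meager (range (e n))) \<and>
     disjoint_family_on U I \<and> disjoint_family_on (\<lambda>n. range (e n)) I \<and> meager (- (\<Union>n\<in>I. U n))"

text \<open>Let \<open>W\<close> be open and equal to \<open>A\<close> up to a meager set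
  \<open>M\<close>. Over an open set missing the projection of \<open>W\<close>, the sections of
  \<open>A\<close> lie in those of \<open>M\<close>, which are meager for generic \<open>x\<close>;
  so the projection is dense and rectangles are available. Each new Cantor set is taken in
  \<open>V n\<close> minus the earlier ones, which form a closed meager set.\<close>

lemma cantor_family_exists:
  fixes A :: "('a::polish_space \<times> 'b::{polish_space, perfect_space}) set"
  assumes "baire_property A" and sections: "meager {x. meager {y. (x, y) \<in> A}}"
  obtains I U H e where "cantor_family I U H e" "\<And>n. n \<in> I \<Longrightarrow> H n \<times> range (e n) \<subseteq> A"
proof -
  obtain W where W: "open W" "meager ((A - W) \<union> (W - A))"
    using assms(1) unfolding baire_property_def by blast
  define M where "M = (A - W) \<union> (W - A)"
  have M: "meager M"
    using W(2) unfolding M_def .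
  have proj: "\<exists>x\<in>O'. \<exists>y. (x, y) \<in> W" if O': "open O'" "O' \<noteq> {}" for O'
  proof (rule ccontr)
    assume "\<not> ?thesis"
    then have "{y. (x, y) \<in> A} \<subseteq> {y. (x, y) \<in> M}" if "x \<in> O'" for x
      using that unfolding M_def by blast
    then have "O' \<subseteq> {x. \<not> meager {y. (x, y) \<in> M}} \<union> {x. meager {y. (x, y) \<in> A}}"
      using meager_subset by fastforce
    then have "meager O'"
      using meager_subset meager_Un[OF meager_sections[OF M] sections] by blast
    then show False
      using not_meager_open[OF O'] by blast
  qed
  obtain I :: "nat set" and U V
    where U: "\<And>n. n \<in> I \<Longrightarrow> open (U n) \<and> U n \<noteq> {}" and V: "\<And>n. n \<in> I \<Longrightarrow> open (V n) \<and> V n \<noteq> {}"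
      and UV: "\<And>n. n \<in> I \<Longrightarrow> U n \<times> V n \<subseteq> W"
      and disjU: "disjoint_family_on U I" and denseU: "meager (- (\<Union>n\<in>I. U n))"
    using disjoint_rectangles[OF W(1) proj] by metis
  \<comment> \<open>The first component of a state is the union of the Cantor sets chosen so far;
    the second holds the most recent embedding and its generic set.\<close>
  define avoid where "avoid n s \<longleftrightarrow> closed (fst s) \<and> meager (fst s)"
    for n :: nat and s :: "'b set \<times> ((nat \<Rightarrow> bool) \<Rightarrow> 'b) \<times> 'a set"
  define add where "add n s s' \<longleftrightarrow> fst s \<subseteq> fst s' \<and> (n \<in> I \<longrightarrow> (case snd s' of (e, H) \<Rightarrow>
      range e \<subseteq> fst s' \<and> continuous_on UNIV e \<and> inj e \<and> range e \<subseteq> V n - fst s \<and> meager (range e) \<and>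
      meager (U n - H) \<and> H \<subseteq> U n \<and> (H \<times> range e) \<inter> M = {}))"
    for n and s s' :: "'b set \<times> ((nat \<Rightarrow> bool) \<Rightarrow> 'b) \<times> 'a set"
  have "\<exists>f. \<forall>n. avoid n (f n) \<and> add n (f n) (f (Suc n))"
  proof (rule dependent_nat_choice)
    show "\<exists>s. avoid 0 s"
      \<comment> \<open>No embedding exists yet; the first step reads only the first component of
        this state.\<close>
      by (intro exI[of _ "({}, undefined)"]) (simp add: avoid_def)
  next
    fix s n assume s: "avoid n s"
    show "\<exists>s'. avoid (Suc n) s' \<and> add n s s'"
    proof (cases "n \<in> I")
      case False
      then show ?thesis
        using s by (intro exI[of _ s]) (simp add: avoid_def add_def)
    next
      case True
      have "V n - fst s \<noteq> {}"
      proof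
        assume "V n - fst s = {}"
        then have "meager (V n)"
          using s meager_subset unfolding avoid_def by blast
        then show False
          using not_meager_open[of "V n"] V[OF True] by blast
      qed
      moreover have "open (V n - fst s)"
        using s V[OF True] unfolding avoid_def by (intro open_Diff) auto
      ultimately obtain e :: "(nat \<Rightarrow> bool) \<Rightarrow> 'b" and H
        where eH: "continuous_on UNIV e" "inj e" "range e \<subseteq> V n - fst s" "meager (range e)"
        "meager (U n - H)" "H \<subseteq> U n" "(H \<times> range e) \<inter> M = {}"
        using generic_cantor_set[of "U n" "V n - fst s" M] U[OF True] M by metis
      have "closed (range e)"
        using compact_continuous_image[OF eH(1) compact_UNIV_codes] compact_imp_closed by blast
      then have "avoid (Suc n) (fst s \<union> range e, e, H)"
        using s eH(4) unfolding avoid_def by (simp add: meager_Un closed_Un)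
      moreover have "add n s (fst s \<union> range e, e, H)"
        using eH unfolding add_def by simp
      ultimately show ?thesis
        by blast
    qed
  qed
  then obtain f where f: "\<And>n. avoid n (f n)" "\<And>n. add n (f n) (f (Suc n))"
    by blast
  define e where "e n = fst (snd (f (Suc n)))" for n
  define H where "H n = snd (snd (f (Suc n)))" for n
  have mono: "fst (f n) \<subseteq> fst (f (Suc n))" for n
    using f(2)[of n] unfolding add_def by blast
  have eH: "range (e n) \<subseteq> fst (f (Suc n))" "continuous_on UNIV (e n)" "inj (e n)"
    "range (e n) \<subseteq> V n - fst (f n)" "meager (range (e n))" "meager (U n - H n)" "H n \<subseteq> U n"
    "(H n \<times> range (e n)) \<inter> M = {}" if "n \<in> I" for n
    using f(2)[of n] that unfolding add_def e_def H_def by (simp_all add: case_prod_beta)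
  have disj_less: "range (e m) \<inter> range (e n) = {}" if "m \<in> I" "n \<in> I" "m < n" for m n
  proof -
    have "range (e m) \<subseteq> fst (f n)"
      using eH(1)[OF that(1)] lift_Suc_mono_le[of "\<lambda>n. fst (f n)", OF mono, of "Suc m" n] that(3) by auto
    then show ?thesis
      using eH(4)[OF that(2)] by blast
  qed
  have "disjoint_family_on (\<lambda>n. range (e n)) I"
    unfolding disjoint_family_on_def
  proof (intro ballI impI)
    fix m n assume "m \<in> I" "n \<in> I" "m \<noteq> n"
    then show "range (e m) \<inter> range (e n) = {}"
      using disj_less[of m n] disj_less[of n m] by (cases m n rule: linorder_cases) auto
  qed
  then have "cantor_family I U H e"
    unfolding cantor_family_def using U eH disjU denseU by simp
  moreover have "H n \<times> range (e n) \<subseteq> A" if "n \<in> I" for n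
  proof -
    \<comment> \<open>Inside \<open>W\<close> and off the symmetric difference \<open>M\<close>, the
      product lies in \<open>A\<close>.\<close>
    have "H n \<times> range (e n) \<subseteq> W"
      using UV[OF that] eH(4,7)[OF that] by blast
    then show ?thesis
      using eH(8)[OF that] unfolding M_def by blast
  qed
  ultimately show thesis
    by (intro that[of I U H e])
qed

text \<open>A generic part of each \<open>U n\<close> is mapped onto its Cantor set. The disjoint
  open sets \<open>U n\<close> make the union of the generic parts \<open>G_delta\<close>, and
  disjoint ranges permit gluing. The set \<open>Z\<close> leaves room for the other half of the
  construction.\<close>

lemma cantor_family_piecewise_homeo:
  fixes U H\<^sub>0 :: "nat \<Rightarrow> 'a::{polish_space, perfect_space} set" and e :: "nat \<Rightarrow> (nat \<Rightarrow> bool) \<Rightarrow> 'b::metric_space"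
  assumes fam: "cantor_family I U H\<^sub>0 e" and Z: "meager Z"
  obtains H C f where "gdelta H" "countable C" "(H \<union> C) \<inter> Z = {}" "meager (- H)"
    "piecewise_homeo (H \<union> C) (\<Union>n\<in>I. range (e n)) f"
    "\<And>x. x \<in> H \<union> C \<Longrightarrow> \<exists>n\<in>I. (x, f x) \<in> H\<^sub>0 n \<times> range (e n)"
proof -
  have U: "open (U n)" "U n \<noteq> {}" "meager (U n - H\<^sub>0 n)" and e: "continuous_on UNIV (e n)" "inj (e n)"
    if "n \<in> I" for n
    using fam that unfolding cantor_family_def by blast+
  have disjU: "disjoint_family_on U I" and disje: "disjoint_family_on (\<lambda>n. range (e n)) I"
    and denseU: "meager (- (\<Union>n\<in>I. U n))"
    using fam unfolding cantor_family_def by blast+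
  have "\<exists>H C f. gdelta H \<and> countable C \<and> H \<union> C \<subseteq> U n \<inter> H\<^sub>0 n - Z \<and> meager (U n - H) \<and>
      piecewise_homeo (H \<union> C) (range (e n)) f" if n: "n \<in> I" for n
    by (rule piecewise_homeo_onto_cantor_set[OF U[OF n] Z e[OF n]]) blast
  then obtain H C f where HCf: "\<And>n. n \<in> I \<Longrightarrow> gdelta (H n) \<and> countable (C n) \<and>
      H n \<union> C n \<subseteq> U n \<inter> H\<^sub>0 n - Z \<and> meager (U n - H n) \<and>
      piecewise_homeo (H n \<union> C n) (range (e n)) (f n)"
    by metis
  have sub: "H n \<union> C n \<subseteq> U n" if "n \<in> I" for n
    using HCf[OF that] by blast
  have disjHC: "disjoint_family_on (\<lambda>n. H n \<union> C n) I"
    unfolding disjoint_family_on_def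
  proof (intro ballI impI)
    fix m n assume "m \<in> I" "n \<in> I" "m \<noteq> n"
    then show "(H m \<union> C m) \<inter> (H n \<union> C n) = {}"
      using sub[of m] sub[of n] disjU unfolding disjoint_family_on_def by blast
  qed
  obtain g where g: "piecewise_homeo (\<Union>n\<in>I. H n \<union> C n) (\<Union>n\<in>I. range (e n)) g"
    "\<And>n x. n \<in> I \<Longrightarrow> x \<in> H n \<union> C n \<Longrightarrow> g x = f n x"
    by (rule piecewise_homeo_UN[of I "\<lambda>n. H n \<union> C n" "\<lambda>n. range (e n)" f])
      (use HCf disjHC disje in auto)
  have eq: "(\<Union>n\<in>I. H n \<union> C n) = (\<Union>n\<in>I. H n) \<union> (\<Union>n\<in>I. C n)"
    by blast
  show thesis
  proof (rule that[of "\<Union>n\<in>I. H n" "\<Union>n\<in>I. C n" g])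
    show "gdelta (\<Union>n\<in>I. H n)"
      by (rule gdelta_UN_disjoint[of I H U]) (use HCf sub U disjU in auto)
    show "countable (\<Union>n\<in>I. C n)"
      using HCf by simp
    show "((\<Union>n\<in>I. H n) \<union> (\<Union>n\<in>I. C n)) \<inter> Z = {}"
      using HCf by blast
    show "piecewise_homeo ((\<Union>n\<in>I. H n) \<union> (\<Union>n\<in>I. C n)) (\<Union>n\<in>I. range (e n)) g"
      using g(1) unfolding eq .
    have "meager (\<Union>n\<in>I. U n - H n)"
      using HCf by (intro meager_UN) simp_all
    then have "meager (- (\<Union>n\<in>I. U n) \<union> (\<Union>n\<in>I. U n - H n))"
      using denseU by (intro meager_Un)
    then show "meager (- (\<Union>n\<in>I. H n))"
      by (rule meager_subset) blast
  next
    fix x assume "x \<in> (\<Union>n\<in>I. H n) \<union> (\<Union>n\<in>I. C n)"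
    then obtain n where n: "n \<in> I" "x \<in> H n \<union> C n"
      by blast
    then have "f n x \<in> range (e n)"
      using HCf[OF n(1)] unfolding piecewise_homeo_def bij_betw_def by blast
    then show "\<exists>n\<in>I. (x, g x) \<in> H\<^sub>0 n \<times> range (e n)"
      using n g(2)[OF n] HCf[OF n(1)] by (intro bexI[of _ n]) auto
  qed
qed

section \<open>Assembling the two halves\<close>

lemma ksigma_countable_Un_compacts:
  fixes C :: "'a::topological_space set"
  assumes "countable C" "countable I" "\<And>i. i \<in> I \<Longrightarrow> compact (P i)"
  shows "ksigma (C \<union> (\<Union>i\<in>I. P i))"
proof -
  define \<K> where "\<K> = insert {} ((\<lambda>x. {x}) ` C \<union> P ` I)"
  have "range (from_nat_into \<K>) = \<K>"
    using assms(1,2) by (intro range_from_nat_into) (auto simp: \<K>_def)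
  moreover have "\<Union>\<K> = C \<union> (\<Union>i\<in>I. P i)"
    unfolding \<K>_def by blast
  moreover have "compact K" if "K \<in> \<K>" for K
    using that assms(3) unfolding \<K>_def by auto
  ultimately show ?thesis
    unfolding ksigma_def by (intro exI[of _ "from_nat_into \<K>"]) (metis rangeI)
qed

lemma baire_property_swap:
  fixes A :: "('a::topological_space \<times> 'b::topological_space) set"
  assumes "baire_property A"
  shows "baire_property (prod.swap ` A)"
proof -
  obtain W where W: "open W" "meager ((A - W) \<union> (W - A))"
    using assms unfolding baire_property_def by blast
  have "prod.swap ` W = prod.swap -` W"
    by force
  moreover have "open (prod.swap -` W)"
    using W(1) by (intro open_vimage) (auto intro!: continuous_intros simp: prod.swap_def)
  ultimately have "open (prod.swap ` W)"
    by simp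
  moreover have "prod.swap ` ((A - W) \<union> (W - A)) =
      (prod.swap ` A - prod.swap ` W) \<union> (prod.swap ` W - prod.swap ` A)"
    by (simp add: image_Un image_set_diff)
  ultimately show ?thesis
    unfolding baire_property_def using meager_swap[OF W(2)] by metis
qed

theorem theorem1p9:
  fixes A :: "('a::{polish_space, perfect_space} \<times> 'b::{polish_space, perfect_space}) set"
  assumes "baire_property A"
    and "meager {x. meager {y. (x, y) \<in> A}}"
    and "meager {y. meager {x. (x, y) \<in> A}}"
  shows "\<exists>(F :: 'a set) (G :: 'b set) (f :: 'a \<Rightarrow> 'b).
           comeager F \<and> comeager G \<and>
           (\<exists>K H. ksigma K \<and> gdelta H \<and> F = K \<union> H) \<and>
           (\<exists>K H. ksigma K \<and> gdelta H \<and> G = K \<union> H) \<and>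
           second_class_iso F G f \<and>
           (\<forall>x\<in>F. (x, f x) \<in> A)"
proof -
  obtain I U H\<^sub>0 and e :: "nat \<Rightarrow> (nat \<Rightarrow> bool) \<Rightarrow> 'b"
    where fam: "cantor_family I U H\<^sub>0 e" and gr: "\<And>n. n \<in> I \<Longrightarrow> H\<^sub>0 n \<times> range (e n) \<subseteq> A"
    using cantor_family_exists[OF assms(1,2)] by metis
  \<comment> \<open>The condition on horizontal sections becomes the one on vertical sections of the
    swapped set, so the same construction yields Cantor sets in the first factor.\<close>
  have "meager {y. meager {x. (y, x) \<in> prod.swap ` A}}"
    using assms(3) by simp
  then obtain I' U' H\<^sub>0' and e' :: "nat \<Rightarrow> (nat \<Rightarrow> bool) \<Rightarrow> 'a"
    where fam': "cantor_family I' U' H\<^sub>0' e'"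
      and gr': "\<And>n. n \<in> I' \<Longrightarrow> H\<^sub>0' n \<times> range (e' n) \<subseteq> prod.swap ` A"
    using cantor_family_exists[OF baire_property_swap[OF assms(1)]] by metis
  define P where "P = (\<Union>n\<in>I. range (e n))"
  define Q where "Q = (\<Union>n\<in>I'. range (e' n))"
  have meager: "meager P" "meager Q"
    unfolding P_def Q_def using fam fam' by (auto intro!: meager_UN simp: cantor_family_def)
  have compact: "\<And>n. n \<in> I \<Longrightarrow> compact (range (e n))" "\<And>n. n \<in> I' \<Longrightarrow> compact (range (e' n))"
    using fam fam' compact_continuous_image[OF _ compact_UNIV_codes]
    unfolding cantor_family_def by blast+
  \<comment> \<open>Both unions of Cantor sets are meager, so each map can have its domain disjoint
    from the range of the other; this is what lets one map be joined with the inverse of the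
    other.\<close>
  obtain H C f where H: "gdelta H" "countable C" "(H \<union> C) \<inter> Q = {}" "meager (- H)"
    "piecewise_homeo (H \<union> C) P f" "\<And>x. x \<in> H \<union> C \<Longrightarrow> \<exists>n\<in>I. (x, f x) \<in> H\<^sub>0 n \<times> range (e n)"
    unfolding P_def by (rule cantor_family_piecewise_homeo[OF fam meager(2)]) blast
  obtain H' C' f' where H': "gdelta H'" "countable C'" "(H' \<union> C') \<inter> P = {}" "meager (- H')"
    "piecewise_homeo (H' \<union> C') Q f'" "\<And>y. y \<in> H' \<union> C' \<Longrightarrow> \<exists>n\<in>I'. (y, f' y) \<in> H\<^sub>0' n \<times> range (e' n)"
    unfolding Q_def by (rule cantor_family_piecewise_homeo[OF fam' meager(1)]) blast
  let ?g = "inv_into (H' \<union> C') f'"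
  \<comment> \<open>Countable sets and countable unions of Cantor sets form the
    \<open>K_sigma\<close> part, the generic set is the \<open>G_delta\<close> part.\<close>
  define F where "F = (C \<union> Q) \<union> H"
  define G where "G = (C' \<union> P) \<union> H'"
  define \<phi> where "\<phi> x = (if x \<in> H \<union> C then f x else ?g x)" for x
  have "piecewise_homeo ((H \<union> C) \<union> Q) (P \<union> (H' \<union> C')) \<phi>"
    unfolding \<phi>_def using H(3,5) H'(3) piecewise_homeo_inv_into[OF H'(5)]
    by (intro piecewise_homeo_Un) auto
  moreover have "(H \<union> C) \<union> Q = F" "P \<union> (H' \<union> C') = G"
    unfolding F_def G_def by blast+
  ultimately have "second_class_iso F G \<phi>"
    using piecewise_homeo_second_class_iso by simp
  moreover have "(x, \<phi> x) \<in> A" if "x \<in> F" for x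
  proof (cases "x \<in> H \<union> C")
    case True
    then show ?thesis
      using H(6)[OF True] gr by (auto simp: \<phi>_def)
  next
    case False
    then have "x \<in> Q"
      using that unfolding F_def by blast
    then have "x \<in> f' ` (H' \<union> C')"
      using H'(5) unfolding piecewise_homeo_def bij_betw_def by simp
    then have y: "?g x \<in> H' \<union> C'" "f' (?g x) = x"
      by (rule inv_into_into, rule f_inv_into_f)
    obtain n where "n \<in> I'" "(?g x, x) \<in> H\<^sub>0' n \<times> range (e' n)"
      using H'(6)[OF y(1)] unfolding y(2) by blast
    \<comment> \<open>The graph of \<open>f'\<close> lies in the swapped set, so the graph of its
      inverse lies in \<open>A\<close>.\<close>
    then have "(?g x, x) \<in> prod.swap ` A"
      using gr' by blast
    then show ?thesis
      using False by (auto simp: \<phi>_def)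
  qed
  moreover have "comeager F" "comeager G"
    unfolding comeager_def F_def G_def using H(4) H'(4) by (auto intro: meager_subset)
  moreover have "ksigma (C \<union> Q)" "ksigma (C' \<union> P)"
    unfolding P_def Q_def using H(2) H'(2) compact by (auto intro: ksigma_countable_Un_compacts)
  ultimately show ?thesis
    using H(1) H'(1) unfolding F_def G_def by blast
qed

end
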